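(* Let $X\subseteq\mathbb{R}^n$ be a subspace with positive reach $\tau$, and let $A\subseteq X$ be such that $d:=\overrightarrow{d_H}(X,A)<\tau/3$. If $\alpha\in(2d,\tau-d)$, then for any integer $k\geq 0$ and any $\epsilon\in(d,\tau-\alpha]$, the $k$-th homology group $H_k(X)$ is isomorphic to the $k$-th persistent homology group $\mathrm{Im}\,\phi_k^{\alpha,\alpha+\epsilon}$, where $$\phi_k^{\alpha,\alpha+\epsilon}:H_k(\mathscr{C}_A(A,\alpha))\to H_k(\mathscr{C}_A(A,\alpha+\epsilon))$$ is the map induced by the inclusion $\mathscr{C}_A(A,\alpha)\hookrightarrow \mathscr{C}_A(A,\alpha+\epsilon)$.
   Context: $\mathbb{R}^n$ carries the Euclidean metric, also denoted $d(\cdot,\cdot)$. Čech complex: for subsets $X,Y$ of a metric space $(M,d)$ and $\alpha>0$, $\mathscr{C}_Y(X,\alpha)$ is the abstract simplicial complex whose simplices are the finite subsets $\sigma\subseteq X$ for which there exists $y\in Y$ with $d(x,y)<\alpha$ for all $x\in\sigma$. In particular $\mathscr{C}_A(A,\alpha)$ is the complex of finite $\sigma\subseteq A$ for which some $a\in A$ satisfies $d(x,a)<\alpha$ for all $x\in\sigma$. For a simplicial complex $K$, $H_k(K)$ means the $k$-th homology of its geometric realization $|K|$; homology is taken with any fixed coefficients. Directed Hausdorff distance: $\overrightarrow{d_H}(X,A):=\sup_{x\in X}\inf_{a\in A}d(x,a)$. Reach: for $X\subseteq \mathbb{R}^n$, let $\mathrm{Unp}(X)$ be the set of all $p\in\mathbb{R}^n$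 having a unique nearest point in $X$, i.e. for which there is exactly one $x\in X$ with $d(x',p)\geq d(x,p)$ for all $x'\in X$. The local reach at $x\in X$ is $\tau(x):=\sup\{r \mid B(x,r)\subseteq \mathrm{Unp}(X)\}$, where $B(x,r)=\{p\in\mathbb{R}^n\mid d(x,p)<r\}$, and the reach of $X$ is $\tau:=\inf_{x\in X}\tau(x)\in[0,\infty]$. The parameters $\alpha$ and $\epsilon$ are real numbers. *)

theory Defs
  imports "HOL-Analysis.Analysis" "HOL-Homology.Homology"
begin

section \<open>Reach and directed Hausdorff distance\<close>

text \<open>All three quantities live in \<^typ>\<open>ennreal\<close>, i.e. in $[0,\infty]$, so that
  the supremum over the empty set is $0$ and the infimum over the empty set is $\infty$.\<close>

definition directed_hausdorff :: "'a::metric_space set \<Rightarrow> 'a set \<Rightarrow> ennreal" where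
  "directed_hausdorff X A = (SUP x\<in>X. INF a\<in>A. ennreal (dist x a))"

definition Unp :: "'a::metric_space set \<Rightarrow> 'a set" where
  "Unp X = {p. \<exists>!x. x \<in> X \<and> (\<forall>x'\<in>X. dist x' p \<ge> dist x p)}"

definition local_reach :: "'a::metric_space set \<Rightarrow> 'a \<Rightarrow> ennreal" where
  "local_reach X x = (SUP r \<in> {r. ball x r \<subseteq> Unp X}. ennreal r)"

definition reach :: "'a::metric_space set \<Rightarrow> ennreal" where
  "reach X = (INF x\<in>X. local_reach X x)"


section \<open>Cech complexes and geometric realization\<close>

definition cech_complex :: "'a::metric_space set \<Rightarrow> 'a set \<Rightarrow> real \<Rightarrow> 'a set set" where
  "cech_complex Y X \<alpha> = {\<sigma>. finite \<sigma> \<and> \<sigma> \<subseteq> X \<and> (\<exists>y\<in>Y. \<forall>x\<in>\<sigma>. dist x y < \<alpha>)}"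

text \<open>A point of the realization is given by its barycentric coordinates, extended by zero to
  all of \<^typ>\<open>'v\<close>.  The empty simplex may belong to a complex; its cell is empty.\<close>

definition geometric_cell :: "'v set \<Rightarrow> ('v \<Rightarrow> real) set" where
  "geometric_cell \<sigma> = {t. (\<forall>v. 0 \<le> t v) \<and> (\<forall>v. v \<notin> \<sigma> \<longrightarrow> t v = 0) \<and> (\<Sum>v\<in>\<sigma>. t v) = 1}"

text \<open>The coherent (weak) topology: a set is open iff it meets every closed cell in a relatively
  open set.  On the cell of a finite simplex the product topology is the Euclidean one, since only
  finitely many coordinates are nonzero there.\<close>

definition geometric_realization :: "'v set set \<Rightarrow> ('v \<Rightarrow> real) topology" where
  "geometric_realization K = topology (\<lambda>U.
     U \<subseteq> (\<Union>\<sigma>\<in>K. geometric_cell \<sigma>) \<and>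
     (\<forall>\<sigma>\<in>K. openin (subtopology (powertop_real UNIV) (geometric_cell \<sigma>))
                   (U \<inter> geometric_cell \<sigma>)))"

lemma openin_geometric_realization:
  "openin (geometric_realization K) U \<longleftrightarrow>
     U \<subseteq> (\<Union>\<sigma>\<in>K. geometric_cell \<sigma>) \<and>
     (\<forall>\<sigma>\<in>K. openin (subtopology (powertop_real UNIV) (geometric_cell \<sigma>))
                   (U \<inter> geometric_cell \<sigma>))"
proof -
  let ?T = "\<lambda>\<sigma>. subtopology (powertop_real UNIV) (geometric_cell \<sigma>)"
  let ?P = "\<lambda>U. U \<subseteq> (\<Union>\<sigma>\<in>K. geometric_cell \<sigma>) \<and>
     (\<forall>\<sigma>\<in>K. openin (?T \<sigma>) (U \<inter> geometric_cell \<sigma>))"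
  have "istopology ?P"
    unfolding istopology_def
  proof (intro conjI allI impI)
    fix S T assume "?P S" "?P T"
    then have "openin (?T \<sigma>) ((S \<inter> T) \<inter> geometric_cell \<sigma>)" if "\<sigma> \<in> K" for \<sigma>
      using openin_Int[of "?T \<sigma>" "S \<inter> geometric_cell \<sigma>" "T \<inter> geometric_cell \<sigma>"] that
      by (simp add: Int_ac)
    with \<open>?P S\<close> show "S \<inter> T \<subseteq> (\<Union>\<sigma>\<in>K. geometric_cell \<sigma>)"
      and "\<forall>\<sigma>\<in>K. openin (?T \<sigma>) (S \<inter> T \<inter> geometric_cell \<sigma>)" by auto
  next
    fix \<K> assume \<K>: "\<forall>S\<in>\<K>. ?P S"
    then show "\<Union>\<K> \<subseteq> (\<Union>\<sigma>\<in>K. geometric_cell \<sigma>)" by blast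
    show "\<forall>\<sigma>\<in>K. openin (?T \<sigma>) (\<Union>\<K> \<inter> geometric_cell \<sigma>)"
    proof
      fix \<sigma> assume "\<sigma> \<in> K"
      then have "openin (?T \<sigma>) (\<Union>S\<in>\<K>. S \<inter> geometric_cell \<sigma>)"
        using \<K> by (intro openin_Union) blast
      then show "openin (?T \<sigma>) (\<Union>\<K> \<inter> geometric_cell \<sigma>)"
        by (simp only: Int_Union2)
    qed
  qed
  then show ?thesis
    by (simp add: geometric_realization_def topology_inverse')
qed

lemma topspace_geometric_realization:
  "topspace (geometric_realization K) = (\<Union>\<sigma>\<in>K. geometric_cell \<sigma>)"
proof
  show "topspace (geometric_realization K) \<subseteq> (\<Union>\<sigma>\<in>K. geometric_cell \<sigma>)"
    using openin_topspace[of "geometric_realization K"]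
    unfolding openin_geometric_realization by (rule conjunct1)
  have "openin (subtopology (powertop_real UNIV) (geometric_cell \<sigma>))
          ((\<Union>\<sigma>\<in>K. geometric_cell \<sigma>) \<inter> geometric_cell \<sigma>)" if "\<sigma> \<in> K" for \<sigma>
  proof -
    have "(\<Union>\<sigma>\<in>K. geometric_cell \<sigma>) \<inter> geometric_cell \<sigma>
          = topspace (subtopology (powertop_real UNIV) (geometric_cell \<sigma>))"
      using that by auto
    then show ?thesis
      by (simp only: openin_topspace)
  qed
  then show "(\<Union>\<sigma>\<in>K. geometric_cell \<sigma>) \<subseteq> topspace (geometric_realization K)"
    by (intro openin_subset) (simp add: openin_geometric_realization)
qed

text \<open>The map of realizations induced by an inclusion of complexes is the identity on barycentric
  coordinates.\<close>

lemma continuous_map_geometric_realization_inclusion: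
  assumes "K \<subseteq> L"
  shows "continuous_map (geometric_realization K) (geometric_realization L) id"
proof -
  let ?K = "\<Union>\<sigma>\<in>K. geometric_cell \<sigma>"
  have "openin (geometric_realization K) (U \<inter> ?K)"
    if "openin (geometric_realization L) U" for U
  proof -
    have "U \<inter> ?K \<inter> geometric_cell \<sigma> = U \<inter> geometric_cell \<sigma>" if "\<sigma> \<in> K" for \<sigma>
      using that by auto
    with that assms show ?thesis
      by (auto simp: openin_geometric_realization)
  qed
  moreover have "{x \<in> topspace (geometric_realization K). id x \<in> U} = U \<inter> ?K" for U
    by (auto simp: topspace_geometric_realization)
  moreover have "topspace (geometric_realization K) \<subseteq> topspace (geometric_realization L)"
    using assms by (auto simp: topspace_geometric_realization)
  ultimately show ?thesis
    by (auto simp: continuous_map_def)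
qed


section \<open>Singular homology with coefficients\<close>

text \<open>HOL-Homology provides singular homology with integer coefficients only.  Here the
  coefficients form an arbitrary abelian group \<^typ>\<open>'g::ab_group_add\<close>: a singular $p$-chain is a
  finitely supported function from singular $p$-simplices to \<^typ>\<open>'g\<close>.  Singular simplices,
  their faces and their images are those of HOL-Homology.\<close>

type_synonym ('a, 'g) coeff_chain = "((nat \<Rightarrow> real) \<Rightarrow> 'a) \<Rightarrow>\<^sub>0 'g"

definition coeff_chains :: "nat \<Rightarrow> 'a topology \<Rightarrow> ('a, 'g::ab_group_add) coeff_chain set" where
  "coeff_chains p X = {c. Poly_Mapping.keys c \<subseteq> singular_simplex_set p X}"

definition coeff_boundary ::
    "nat \<Rightarrow> ('a, 'g::ab_group_add) coeff_chain \<Rightarrow> ('a, 'g) coeff_chain" where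
  "coeff_boundary p c =
     (if p = 0 then 0 else
      \<Sum>f\<in>Poly_Mapping.keys c. \<Sum>k\<le>p. Poly_Mapping.single (singular_face p k f)
        (if even k then Poly_Mapping.lookup c f else - Poly_Mapping.lookup c f))"

definition coeff_chain_map ::
    "nat \<Rightarrow> ('a \<Rightarrow> 'b) \<Rightarrow> ('a, 'g::ab_group_add) coeff_chain \<Rightarrow> ('b, 'g) coeff_chain" where
  "coeff_chain_map p f c =
     (\<Sum>s\<in>Poly_Mapping.keys c. Poly_Mapping.single (simplex_map p f s) (Poly_Mapping.lookup c s))"

definition coeff_cycles :: "nat \<Rightarrow> 'a topology \<Rightarrow> ('a, 'g::ab_group_add) coeff_chain set" where
  "coeff_cycles p X = {c \<in> coeff_chains p X. coeff_boundary p c = 0}"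

definition coeff_boundaries :: "nat \<Rightarrow> 'a topology \<Rightarrow> ('a, 'g::ab_group_add) coeff_chain set" where
  "coeff_boundaries p X = coeff_boundary (Suc p) ` coeff_chains (Suc p) X"

definition coeff_cycle_group ::
    "nat \<Rightarrow> 'a topology \<Rightarrow> ('a, 'g::ab_group_add) coeff_chain monoid" where
  "coeff_cycle_group p X = \<lparr>carrier = coeff_cycles p X, monoid.mult = (+), one = 0\<rparr>"

definition coeff_homology_group ::
    "'g::ab_group_add itself \<Rightarrow> nat \<Rightarrow> 'a topology \<Rightarrow> ('a, 'g) coeff_chain set monoid" where
  "coeff_homology_group G p X = coeff_cycle_group p X Mod coeff_boundaries p X"

text \<open>The induced map sends the class of a cycle \<open>c\<close> to the class of its image; since elements of
  the quotient group are cosets, this is written as a union over the representatives \<open>c\<close>, each of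
  which contributes the same coset when \<open>f\<close> is continuous from \<open>X\<close> to \<open>Y\<close>.\<close>

definition coeff_hom_induced ::
    "'g::ab_group_add itself \<Rightarrow> nat \<Rightarrow> 'b topology \<Rightarrow> ('a \<Rightarrow> 'b) \<Rightarrow>
     ('a, 'g) coeff_chain set \<Rightarrow> ('b, 'g) coeff_chain set" where
  "coeff_hom_induced G p Y f C =
     (\<Union>c\<in>C. coeff_boundaries p Y #>\<^bsub>coeff_cycle_group p Y\<^esub> coeff_chain_map p f c)"

text \<open>For integer coefficients these notions agree with those of HOL-Homology.\<close>

lemma frag_cmul_single: "frag_cmul n (Poly_Mapping.single s m) = Poly_Mapping.single s (n * m)"
  by (rule poly_mapping_eqI) (simp add: lookup_single when_def)

lemma coeff_boundary_int:
  fixes c :: "'a chain"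
  shows "coeff_boundary p c = chain_boundary p c"
proof -
  have "frag_cmul n (\<Sum>k\<le>p. frag_cmul ((-1) ^ k) (frag_of (singular_face p k f)))
      = (\<Sum>k\<le>p. Poly_Mapping.single (singular_face p k f) (if even k then n else - n))"
    for n and f :: "(nat \<Rightarrow> real) \<Rightarrow> 'a"
    unfolding frag_cmul_sum frag_cmul_single
    by (intro sum.cong refl) (simp add: minus_one_power_iff)
  then show ?thesis
    by (simp only: coeff_boundary_def chain_boundary_def frag_extend_def)
qed

lemma coeff_chain_map_int:
  fixes f :: "'a \<Rightarrow> 'b"
  shows "coeff_chain_map p f c = chain_map p f c"
  by (simp only: coeff_chain_map_def chain_map_def frag_extend_def o_def frag_cmul_single mult_1_right)

lemma coeff_chains_int: "coeff_chains p X = singular_chain_set p X"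
  by (auto simp: coeff_chains_def singular_chain_def)

lemma coeff_cycles_int: "coeff_cycles p X = singular_relcycle_set p X {}"
  by (auto simp: coeff_cycles_def coeff_chains_int coeff_boundary_int singular_cycle)

lemma coeff_boundaries_int: "coeff_boundaries p X = singular_relboundary_set p X {}"
  by (auto simp: coeff_boundaries_def coeff_chains_int coeff_boundary_int singular_boundary)

lemma coeff_cycle_group_int: "coeff_cycle_group p X = relcycle_group p X {}"
proof -
  have "carrier (relcycle_group p X {}) = singular_relcycle_set p X {}"
    by simp
  then show ?thesis
    by (simp add: coeff_cycle_group_def coeff_cycles_int relcycle_group_def chain_group_def
        subgroup_generated_def free_Abelian_group_def)
qed

lemma coeff_homology_group_int:
  "coeff_homology_group TYPE(int) p X = homology_group (int p) X"
  by (simp add: coeff_homology_group_def coeff_cycle_group_int coeff_boundaries_int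
      nontrivial_relative_homology_group)

lemma coeff_hom_induced_int:
  assumes f: "continuous_map X Y f" and C: "C \<in> carrier (homology_group (int p) X)"
  shows "coeff_hom_induced TYPE(int) p Y f C = hom_induced (int p) X {} Y {} f C"
proof -
  obtain c where c: "singular_relcycle p X {} c" "C = homologous_rel_set p X {} c"
    using C by (auto simp: carrier_relative_homology_group)
  have "homologous_rel_set p Y {} (chain_map p f c') = homologous_rel_set p Y {} (chain_map p f c)"
    if "c' \<in> C" for c'
  proof -
    have "singular_relboundary p X {} (c - c')"
      using that unfolding c(2) homologous_rel_def by simp
    then have "singular_relboundary p Y {} (chain_map p f c - chain_map p f c')"
      using singular_relboundary_chain_map[of p X "{}" "c - c'" Y f "{}"] f
      unfolding chain_map_diff by simp
    then have "homologous_rel p Y {} (chain_map p f c) (chain_map p f c')"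
      by (simp add: homologous_rel_def)
    then have "homologous_rel_set p Y {} (chain_map p f c) = homologous_rel_set p Y {} (chain_map p f c')"
      by (simp only: homologous_rel_set_eq)
    then show ?thesis
      by (rule sym)
  qed
  moreover have "c \<in> C"
    unfolding c(2) by simp
  ultimately have "(\<Union>c'\<in>C. homologous_rel_set p Y {} (chain_map p f c'))
                   = homologous_rel_set p Y {} (chain_map p f c)"
    by (intro SUP_eq_const) blast+
  then have "coeff_hom_induced TYPE(int) p Y f C = homologous_rel_set p Y {} (chain_map p f c)"
    by (simp only: coeff_hom_induced_def coeff_cycle_group_int coeff_boundaries_int
        coeff_chain_map_int right_coset_singular_relboundary)
  also have "\<dots> = hom_induced (int p) X {} Y {} f C"
    unfolding c(2) by (rule hom_induced_chain_map[OF f _ c(1), symmetric]) simp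
  finally show ?thesis .
qed


section \<open>Persistent homology\<close>

text \<open>For a subcomplex \<open>K\<close> of \<open>L\<close>: the image of the map $H_k(K) \to H_k(L)$ induced by the
  inclusion, as a group with the operation of $H_k(L)$.\<close>

definition persistent_homology_group ::
    "'g::ab_group_add itself \<Rightarrow> nat \<Rightarrow> 'v set set \<Rightarrow> 'v set set \<Rightarrow>
     ('v \<Rightarrow> real, 'g) coeff_chain set monoid" where
  "persistent_homology_group G k K L =
     (coeff_homology_group G k (geometric_realization L))
       \<lparr>carrier := coeff_hom_induced G k (geometric_realization L) id `
                    carrier (coeff_homology_group G k (geometric_realization K))\<rparr>"

end

theory Submission
  imports Defs
begin

text \<open>Write $K$ and $L$ for the Cech complexes at $\alpha$ and $\alpha+\epsilon$.  A partition of
  unity subordinate to the balls of radius $\delta$ about $A$, with $\delta$ slightly larger than $d$,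
  gives a map $s : X \to |K|$.  In the other direction, choose for every simplex a witness in $A$;
  averaging the witnesses of the faces that contain all large barycentric coordinates of $t$, and
  then taking the nearest point in $X$, gives a map $q : |L| \to X$.  The segment from $x$ to the
  average at $s(x)$ stays within distance $\alpha+\delta\le\tau$ of $x$, so $q \circ s \simeq \mathrm{id}_X$.
  For $t \in |K|$ the averaged witnesses all lie in the $\alpha$-balls about the large vertices of $t$,
  and, since $\alpha<\tau$, so does $q(t)$: the projection of a convex combination of points of $X$
  in a ball about a point of $X$ remains in that ball.  Hence $t$ can be moved first to its large
  vertices and then to $s(q(t))$ inside simplices of $L$, so $s \circ q$ is homotopic to the
  inclusion $|K| \to |L|$.  Therefore $s$ induces an isomorphism of $H_k(X)$ onto the image of
  $H_k(K) \to H_k(L)$.\<close>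

section \<open>Chains with coefficients\<close>

text \<open>Homology with coefficients is reduced to integral chains: the boundary of a simplex and
  the prism over it are integral, and tensoring with a coefficient turns integral identities into
  the required ones. On the geometric side, the witness of a face is tied only to the vertices of
  that face. Hence only faces containing the large vertices get weight, and only those vertices are
  shown to be near \<open>proj t\<close>; this is why the homotopy from the inclusion to
  \<open>s \<circ> proj\<close> passes through \<open>shrink\<close>. Moreover \<open>A\<close> may
  be infinite, and then continuity of the coordinates does not give continuity into the coherent
  topology; maps into a realization are therefore required to have locally finite supports. The
  enlargement from \<open>K\<close> to \<open>L\<close> pays for the fact that \<open>proj t\<close>
  is a point of \<open>X\<close> and not of \<open>A\<close>: a point of \<open>A\<close> within
  \<delta> \<le> \<epsilon> replaces it as a witness.\<close>

definition chain_extend :: "('a \<Rightarrow> 'g \<Rightarrow> 'h) \<Rightarrow> ('a \<Rightarrow>\<^sub>0 'g::ab_group_add) \<Rightarrow> 'h::ab_group_add"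
  where "chain_extend F c = (\<Sum>s\<in>Poly_Mapping.keys c. F s (Poly_Mapping.lookup c s))"

lemma chain_extend_add:
  assumes "\<And>s. Modules.additive (F s)"
  shows "chain_extend F (a + b) = chain_extend F a + chain_extend F b"
  unfolding chain_extend_def
  by (rule setsum_keys_plus_distrib)
    (use assms in \<open>auto simp: additive.add additive.zero\<close>)

lemma additive_chain_extend: "(\<And>s. Modules.additive (F s)) \<Longrightarrow> Modules.additive (chain_extend F)"
  by (simp add: Modules.additive_def chain_extend_add)

lemma chain_extend_single:
  assumes "Modules.additive (F s)"
  shows "chain_extend F (Poly_Mapping.single s g) = F s g"
  using assms by (auto simp: chain_extend_def additive.zero)

lemma sum_single_lookup:
  "(\<Sum>s\<in>Poly_Mapping.keys c. Poly_Mapping.single s (Poly_Mapping.lookup c s)) = c"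
  by (rule poly_mapping_eqI) (auto simp: lookup_sum lookup_single when_def in_keys_iff)

text \<open>Every chain is a sum of one-term chains. Agreement is asked only over the keys of
  \<open>c\<close>, because identities such as naturality of the boundary are available only for
  singular simplices of the space at hand.\<close>

lemma additive_eqI:
  fixes \<Phi> \<Psi> :: "('a \<Rightarrow>\<^sub>0 'g::ab_group_add) \<Rightarrow> 'h::ab_group_add"
  assumes "Modules.additive \<Phi>" "Modules.additive \<Psi>"
    and "\<And>s g. s \<in> Poly_Mapping.keys c \<Longrightarrow> \<Phi> (Poly_Mapping.single s g) = \<Psi> (Poly_Mapping.single s g)"
  shows "\<Phi> c = \<Psi> c"
proof -
  have "\<Phi> (\<Sum>s\<in>Poly_Mapping.keys c. Poly_Mapping.single s (Poly_Mapping.lookup c s))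
      = \<Psi> (\<Sum>s\<in>Poly_Mapping.keys c. Poly_Mapping.single s (Poly_Mapping.lookup c s))"
    using assms by (simp add: additive.sum)
  then show ?thesis
    by (simp add: sum_single_lookup)
qed

lemma additive_single: "Modules.additive (Poly_Mapping.single s)"
  by (simp add: Modules.additive_def single_add)

lemma additive_comp: "Modules.additive f \<Longrightarrow> Modules.additive g \<Longrightarrow> Modules.additive (\<lambda>x. f (g x))"
  by (simp add: Modules.additive_def)

lemma additive_minus:
  fixes f g :: "'a::ab_group_add \<Rightarrow> 'b::ab_group_add"
  shows "Modules.additive f \<Longrightarrow> Modules.additive g \<Longrightarrow> Modules.additive (\<lambda>x. f x - g x)"
  by (simp add: Modules.additive_def)

lemma additive_sum_fun:
  fixes f :: "'i \<Rightarrow> 'a::ab_group_add \<Rightarrow> 'b::ab_group_add"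
  shows "(\<And>i. Modules.additive (f i)) \<Longrightarrow> Modules.additive (\<lambda>x. \<Sum>i\<in>I. f i x)"
  by (simp add: Modules.additive_def sum.distrib)

section \<open>Integer multiples, and integral chains tensored with a coefficient\<close>

definition int_scale :: "int \<Rightarrow> 'g::ab_group_add \<Rightarrow> 'g" where
  "int_scale n g = (\<Sum>i<nat n. g) - (\<Sum>i<nat (- n). g)"

lemma int_scale_0 [simp]: "int_scale 0 g = 0"
  and int_scale_1 [simp]: "int_scale 1 g = g"
  by (simp_all add: int_scale_def)

lemma int_scale_add_1: "int_scale (n + 1) g = int_scale n g + g"
proof (cases "n \<ge> 0")
  case True
  then have "nat (n + 1) = Suc (nat n)" "nat (- n) = 0" "nat (- n - 1) = 0" by auto
  then show ?thesis by (simp add: int_scale_def)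
next
  case False
  then have "nat (- n) = Suc (nat (- (n + 1)))" "nat (n + 1) = 0" "nat n = 0" by auto
  then show ?thesis unfolding int_scale_def by (simp del: minus_add_distrib)
qed

lemma additive_int_scale_left: "Modules.additive (\<lambda>n. int_scale n g)"
proof
  fix m n
  show "int_scale (m + n) g = int_scale m g + int_scale n g"
  proof (induction n rule: int_induct[where k = 0])
    case (step1 i)
    then show ?case using int_scale_add_1[of "m + i" g] int_scale_add_1[of i g] by (simp add: add.assoc)
  next
    case (step2 i)
    then show ?case using int_scale_add_1[of "m + (i - 1)" g] int_scale_add_1[of "i - 1" g]
      by (simp add: algebra_simps)
  qed simp
qed

lemma additive_int_scale: "Modules.additive (int_scale n)"
  by standard (simp add: int_scale_def sum.distrib)

text \<open>This is \<open>c\<close> tensored with \<open>g\<close>. It is additive in both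
  arguments and commutes with boundaries and induced maps, and so carries identities between
  integral chains over to coefficients in any abelian group.\<close>

definition chain_tensor :: "'g::ab_group_add \<Rightarrow> ('a \<Rightarrow>\<^sub>0 int) \<Rightarrow> ('a \<Rightarrow>\<^sub>0 'g)" where
  "chain_tensor g = chain_extend (\<lambda>s n. Poly_Mapping.single s (int_scale n g))"

lemma additive_chain_tensor: "Modules.additive (chain_tensor g)"
  unfolding chain_tensor_def
  by (rule additive_chain_extend, rule additive_comp[OF additive_single additive_int_scale_left])

lemma additive_chain_tensor_left: "Modules.additive (\<lambda>g. chain_tensor g c)"
  unfolding chain_tensor_def chain_extend_def
  by (rule additive_sum_fun, rule additive_comp[OF additive_single additive_int_scale])

lemma chain_tensor_frag_of [simp]: "chain_tensor g (frag_of s) = Poly_Mapping.single s g"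
  unfolding chain_tensor_def
  by (subst chain_extend_single) (simp_all add: additive_comp[OF additive_single additive_int_scale_left])

lemma keys_chain_tensor: "Poly_Mapping.keys (chain_tensor g c) \<subseteq> Poly_Mapping.keys c"
proof -
  have "Poly_Mapping.keys (chain_tensor g c)
      \<subseteq> (\<Union>s\<in>Poly_Mapping.keys c. Poly_Mapping.keys (Poly_Mapping.single s (int_scale (Poly_Mapping.lookup c s) g)))"
    unfolding chain_tensor_def chain_extend_def by (rule keys_sum)
  then show ?thesis by (fastforce split: if_splits)
qed

section \<open>Boundaries and induced chain maps with coefficients\<close>

lemma coeff_boundary_eq_chain_extend:
  "coeff_boundary p = chain_extend (\<lambda>f g. if p = 0 then 0 else
     \<Sum>k\<le>p. Poly_Mapping.single (singular_face p k f) (if even k then g else - g))"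
  by (auto simp: coeff_boundary_def chain_extend_def fun_eq_iff)

lemma coeff_chain_map_eq_chain_extend:
  "coeff_chain_map p f = chain_extend (\<lambda>s. Poly_Mapping.single (simplex_map p f s))"
  by (simp add: coeff_chain_map_def chain_extend_def fun_eq_iff)

lemma additive_coeff_chain_map: "Modules.additive (coeff_chain_map p f)"
  unfolding coeff_chain_map_eq_chain_extend by (intro additive_chain_extend additive_single)

lemma additive_boundary_single:
  fixes s :: "(nat \<Rightarrow> real) \<Rightarrow> 'a"
  shows "Modules.additive (\<lambda>g::'g::ab_group_add. if p = 0 then 0 else
     \<Sum>k\<le>p. Poly_Mapping.single (singular_face p k s) (if even k then g else - g))"
proof -
  have "Modules.additive (\<lambda>g::'g. Poly_Mapping.single (singular_face p k s) (if even k then g else - g))" for k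
    by (simp add: Modules.additive_def single_add flip: single_uminus) (simp add: single_add[symmetric] single_uminus[symmetric])
  then have "Modules.additive (\<lambda>g::'g. \<Sum>k\<le>p. Poly_Mapping.single (singular_face p k s) (if even k then g else - g))"
    by (rule additive_sum_fun)
  then show ?thesis by (simp add: Modules.additive_def)
qed

lemma additive_coeff_boundary: "Modules.additive (coeff_boundary p)"
  unfolding coeff_boundary_eq_chain_extend by (intro additive_chain_extend additive_boundary_single)

lemma coeff_chain_map_single [simp]:
  "coeff_chain_map p f (Poly_Mapping.single s g) = Poly_Mapping.single (simplex_map p f s) g"
  by (simp add: coeff_chain_map_eq_chain_extend chain_extend_single additive_single)

text \<open>Faces and signs are integral data which the coefficient only multiplies. Identities for
  \<open>coeff_boundary\<close> can hence be checked on one-term chains in the integral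
  theory.\<close>

lemma coeff_boundary_single:
  "coeff_boundary p (Poly_Mapping.single s g) = chain_tensor g (chain_boundary p (frag_of s))"
proof (cases "p = 0")
  case False
  interpret T: Modules.additive "chain_tensor g" by (rule additive_chain_tensor)
  have "chain_tensor g (frag_cmul ((-1) ^ k) (frag_of f)) =
      Poly_Mapping.single f (if even k then g else - g)" for k and f :: "(nat \<Rightarrow> real) \<Rightarrow> 'a"
    by (simp add: minus_one_power_iff T.minus single_uminus)
  with False show ?thesis
    unfolding coeff_boundary_eq_chain_extend chain_boundary_of
    by (subst chain_extend_single) (rule additive_boundary_single, simp add: T.sum)
qed (simp add: coeff_boundary_def chain_boundary_def additive.zero[OF additive_chain_tensor])

lemma coeff_chain_map_tensor:
  "coeff_chain_map p f (chain_tensor g c) = chain_tensor g (chain_map p f c)"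
proof -
  let ?P = "\<lambda>c. coeff_chain_map p f (chain_tensor g c) = chain_tensor g (chain_map p f c)"
  show ?thesis
  using subset_UNIV
proof (induction c rule: frag_induction)
    case (diff a b)
    then show ?case
      by (simp add: chain_map_diff additive.diff[OF additive_chain_tensor]
          additive.diff[OF additive_coeff_chain_map])
  qed (simp_all add: additive.zero[OF additive_chain_tensor] additive.zero[OF additive_coeff_chain_map])
qed

lemma coeff_boundary_tensor:
  "coeff_boundary p (chain_tensor g c) = chain_tensor g (chain_boundary p c)"
using subset_UNIV
proof (induction c rule: frag_induction)
    case (diff a b)
    then show ?case
      by (simp add: chain_boundary_diff additive.diff[OF additive_chain_tensor]
          additive.diff[OF additive_coeff_boundary])
qed (simp_all add: coeff_boundary_single additive.zero[OF additive_chain_tensor] additive.zero[OF additive_coeff_boundary])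

lemma coeff_boundary_chain_map:
  assumes "c \<in> coeff_chains p X"
  shows "coeff_boundary p (coeff_chain_map p f c) = coeff_chain_map (p - Suc 0) f (coeff_boundary p c)"
proof (rule additive_eqI[where c = c])
  fix s g assume "s \<in> Poly_Mapping.keys c"
  with assms have "singular_chain p X (frag_of s)"
    by (auto simp: coeff_chains_def singular_chain_of)
  then have "chain_boundary p (chain_map p f (frag_of s)) = chain_map (p - Suc 0) f (chain_boundary p (frag_of s))"
    by (rule chain_boundary_chain_map)
  then show "coeff_boundary p (coeff_chain_map p f (Poly_Mapping.single s g)) =
      coeff_chain_map (p - Suc 0) f (coeff_boundary p (Poly_Mapping.single s g))"
    by (simp add: coeff_boundary_single coeff_chain_map_tensor)
qed (rule additive_comp[OF additive_coeff_boundary additive_coeff_chain_map]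
    additive_comp[OF additive_coeff_chain_map additive_coeff_boundary])+

lemma coeff_chains_add: "a \<in> coeff_chains p X \<Longrightarrow> b \<in> coeff_chains p X \<Longrightarrow> a + b \<in> coeff_chains p X"
  using keys_add[of a b] by (auto simp: coeff_chains_def)

lemma coeff_chains_diff: "a \<in> coeff_chains p X \<Longrightarrow> b \<in> coeff_chains p X \<Longrightarrow> a - b \<in> coeff_chains p X"
  using keys_diff[of a b] by (auto simp: coeff_chains_def)

lemma coeff_chains_0: "0 \<in> coeff_chains p X"
  by (simp add: coeff_chains_def)

lemma coeff_chains_sum: "(\<And>i. i \<in> I \<Longrightarrow> f i \<in> coeff_chains p X) \<Longrightarrow> sum f I \<in> coeff_chains p X"
  by (induction I rule: infinite_finite_induct) (auto intro: coeff_chains_add coeff_chains_0)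

lemma coeff_chains_extend:
  assumes "c \<in> coeff_chains p X" "\<And>s g. singular_simplex p X s \<Longrightarrow> F s g \<in> coeff_chains q Y"
  shows "chain_extend F c \<in> coeff_chains q Y"
  unfolding chain_extend_def using assms by (intro coeff_chains_sum) (auto simp: coeff_chains_def)

lemma chain_tensor_in_chains: "singular_chain p X c \<Longrightarrow> chain_tensor g c \<in> coeff_chains p X"
  using keys_chain_tensor[of g c] by (auto simp: coeff_chains_def singular_chain_def)

lemma coeff_chain_map_in_chains:
  assumes "c \<in> coeff_chains p X" "continuous_map X Y f"
  shows "coeff_chain_map p f c \<in> coeff_chains p Y"
  unfolding coeff_chain_map_eq_chain_extend
  using assms(1) by (rule coeff_chains_extend)
    (auto simp: coeff_chains_def singular_simplex_simplex_map[OF _ assms(2)])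

lemma coeff_chain_map_compose:
  fixes c :: "('a, 'g::ab_group_add) coeff_chain"
  shows
  "coeff_chain_map p (h \<circ> f) c = coeff_chain_map p h (coeff_chain_map p f c)"
proof (rule additive_eqI[where c = c])
  fix s and g :: 'g
  have "simplex_map p (h \<circ> f) s = simplex_map p h (simplex_map p f s)"
    by (simp only: simplex_map_compose o_apply)
  then show "coeff_chain_map p (h \<circ> f) (Poly_Mapping.single s g)
      = coeff_chain_map p h (coeff_chain_map p f (Poly_Mapping.single s g))"
    by (simp only: coeff_chain_map_single)
qed (rule additive_coeff_chain_map additive_comp[OF additive_coeff_chain_map additive_coeff_chain_map])+

lemma coeff_chain_map_ident:
  assumes "c \<in> coeff_chains p X" "\<And>x. x \<in> topspace X \<Longrightarrow> f x = x"
  shows "coeff_chain_map p f c = c"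
proof (rule additive_eqI[where c = c and \<Psi> = "\<lambda>c. c"])
  fix s and g :: 'b assume "s \<in> Poly_Mapping.keys c"
  with assms have "simplex_map p f s = s"
    by (intro simplex_map_id_gen[of p X]) (auto simp: coeff_chains_def)
  then show "coeff_chain_map p f (Poly_Mapping.single s g) = Poly_Mapping.single s g"
    by simp
qed (rule additive_coeff_chain_map, simp add: Modules.additive_def)

section \<open>Homotopy invariance\<close>

abbreviation simplex_space :: "nat \<Rightarrow> (nat \<Rightarrow> real) topology" where
  "simplex_space p \<equiv> subtopology (powertop_real UNIV) (standard_simplex p)"

abbreviation cylinder :: "'a topology \<Rightarrow> (real \<times> 'a) topology" where
  "cylinder X \<equiv> prod_topology (top_of_set {0..1}) X"

text \<open>Every singular simplex \<open>s\<close> is the image of this one under \<open>s\<close>.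
  The restriction is there because singular simplices are extensional outside the standard
  simplex.\<close>

abbreviation universal_simplex :: "nat \<Rightarrow> (nat \<Rightarrow> real) chain" where
  "universal_simplex p \<equiv> frag_of (restrict id (standard_simplex p))"

definition prism_chain :: "nat \<Rightarrow> (real \<times> (nat \<Rightarrow> real)) chain \<Rightarrow> 'a chain \<Rightarrow> (real \<times> 'a) chain" where
  "prism_chain p d = frag_extend (\<lambda>s. chain_map (Suc p) (map_prod id s) d)"

text \<open>The prism operator is found by the method of acyclic models: by naturality it is
  determined by its value \<open>d\<close> on the universal simplex, and \<open>d\<close> exists because the cylinder over
  the standard simplex is acyclic.  Here \<open>d'\<close> is the model one dimension below.\<close>

definition prism_model :: "nat \<Rightarrow> (real \<times> (nat \<Rightarrow> real)) chain \<Rightarrow> (real \<times> (nat \<Rightarrow> real)) chain \<Rightarrow> bool" where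
  "prism_model p d' d \<longleftrightarrow> singular_chain (Suc p) (cylinder (simplex_space p)) d \<and>
     chain_boundary (Suc p) d = chain_map p (Pair 1) (universal_simplex p)
       - chain_map p (Pair 0) (universal_simplex p)
       - prism_chain (p - 1) d' (chain_boundary p (universal_simplex p))"

lemma singular_chain_universal_simplex: "singular_chain p (simplex_space p) (universal_simplex p)"
  by (simp add: singular_chain_of singular_simplex_def)

lemma continuous_map_cylinder:
  "continuous_map X Y f \<Longrightarrow> continuous_map (cylinder X) (cylinder Y) (map_prod id f)"
  by (auto intro!: continuous_map_pairedI continuous_map_compose[unfolded o_def, OF continuous_map_snd]
      continuous_map_fst simp: map_prod_def case_prod_unfold)

lemma singular_chain_prism_chain:
  assumes "singular_chain p X c" "singular_chain (Suc p) (cylinder (simplex_space p)) d"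
  shows "singular_chain (Suc p) (cylinder X) (prism_chain p d c)"
  unfolding prism_chain_def
proof (rule singular_chain_extend)
  fix s assume "s \<in> Poly_Mapping.keys c"
  with assms(1) have "continuous_map (simplex_space p) X s"
    by (auto simp: singular_chain_def singular_simplex_def)
  then show "singular_chain (Suc p) (cylinder X) (chain_map (Suc p) (map_prod id s) d)"
    using assms(2) continuous_map_cylinder singular_chain_chain_map by blast
qed

text \<open>Pushing the model forward is functorial. Since \<open>simplex_map p f s\<close> is
  restricted to the standard simplex, the two composite maps are compared only on the cylinder over
  it, where \<open>d\<close> lives.\<close>

lemma chain_map_prism_chain:
  assumes "singular_chain p X c" "singular_chain (Suc p) (cylinder (simplex_space p)) d"
  shows "chain_map (Suc p) (map_prod id f) (prism_chain p d c) = prism_chain p d (chain_map p f c)"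
  using assms(1) unfolding singular_chain_def
proof (induction c rule: frag_induction)
  case (one s)
  have "chain_map (Suc p) (map_prod id f) (chain_map (Suc p) (map_prod id s) d)
      = chain_map (Suc p) (map_prod id f \<circ> map_prod id s) d"
    by (simp add: chain_map_compose)
  also have "\<dots> = chain_map (Suc p) (map_prod id (simplex_map p f s)) d"
    using assms(2) by (rule chain_map_eq) (auto simp: simplex_map_def)
  finally show ?case unfolding prism_chain_def by (simp only: frag_extend_of chain_map_of)
qed (simp_all add: prism_chain_def frag_extend_diff chain_map_diff)

text \<open>The equation of the model is pushed forward along \<open>map_prod id s\<close>;
  naturality rewrites each term, and linearity extends the result from simplices to chains.\<close>

lemma chain_boundary_prism_chain:
  assumes "singular_chain p X c" "prism_model p d' d"
    and "p > 0 \<Longrightarrow> singular_chain p (cylinder (simplex_space (p - 1))) d'"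
  shows "chain_boundary (Suc p) (prism_chain p d c)
       = chain_map p (Pair 1) c - chain_map p (Pair 0) c - prism_chain (p - 1) d' (chain_boundary p c)"
  using assms(1) unfolding singular_chain_def
proof (induction c rule: frag_induction)
  case (one s)
  then have s: "singular_simplex p X s" by simp
  let ?u = "universal_simplex p"
  have su: "chain_map p s ?u = frag_of s"
    using s by (rule singular_simplex_chain_map_id)
  have d: "singular_chain (Suc p) (cylinder (simplex_space p)) d"
    using assms(2) by (simp add: prism_model_def)
  have "chain_map p (map_prod id s) (prism_chain (p - 1) d' (chain_boundary p ?u))
      = prism_chain (p - 1) d' (chain_boundary p (frag_of s))"
  \<comment> \<open>For \<open>p = 0\<close> the truncated index \<open>p - 1\<close> is harmless,
    since the boundary is zero.\<close>
  proof (cases "p = 0")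
    case True
    then show ?thesis by (simp add: chain_boundary_def prism_chain_def)
  next
    case False
    then have "Suc (p - 1) = p" by simp
    moreover have "singular_chain (p - 1) (simplex_space p) (chain_boundary p ?u)"
      using singular_chain_boundary[OF singular_chain_universal_simplex[of p]] by simp
    ultimately have "chain_map p (map_prod id s) (prism_chain (p - 1) d' (chain_boundary p ?u))
        = prism_chain (p - 1) d' (chain_map (p - 1) s (chain_boundary p ?u))"
      using chain_map_prism_chain[of "p - 1" "simplex_space p" _ d' s] assms(3) False by simp
    also have "chain_map (p - 1) s (chain_boundary p ?u) = chain_boundary p (frag_of s)"
      using chain_boundary_chain_map[OF singular_chain_universal_simplex[of p], of s] su by simp
    finally show ?thesis .
  qed
  moreover have "chain_map p (map_prod id s) (chain_map p (Pair u) ?u) = chain_map p (Pair u) (frag_of s)" for u :: real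
  proof -
    have "chain_map p (map_prod id s) (chain_map p (Pair u) ?u) = chain_map p (map_prod id s \<circ> Pair u) ?u"
      by (simp add: chain_map_compose del: chain_map_of)
    also have "map_prod id s \<circ> Pair u = Pair u \<circ> s" by auto
    also have "chain_map p (Pair u \<circ> s) ?u = chain_map p (Pair u) (chain_map p s ?u)"
      by (simp add: chain_map_compose del: chain_map_of)
    finally show ?thesis unfolding su .
  qed
  moreover have "chain_boundary (Suc p) (prism_chain p d (frag_of s)) = chain_map p (map_prod id s) (chain_boundary (Suc p) d)"
    using chain_boundary_chain_map[OF d, of "map_prod id s"] by (simp add: prism_chain_def)
  ultimately show ?case
    using assms(2) by (simp add: prism_model_def chain_map_diff del: chain_map_of)
qed (simp_all add: prism_chain_def frag_extend_diff chain_map_diff chain_boundary_diff)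

text \<open>Both factors of the cylinder are convex, so the straight-line contraction works. The
  condition on maps from \<open>{}\<close> to \<open>{}\<close> is vacuous; it expresses a homotopy
  of pairs with empty subspace.\<close>

lemma homotopic_with_cylinder_id_const:
  assumes "a \<in> standard_simplex n"
  shows "homotopic_with (\<lambda>h. h \<in> {} \<rightarrow> {}) (cylinder (simplex_space n)) (cylinder (simplex_space n)) id (\<lambda>_. (0, a))"
  unfolding homotopic_with_def
proof (intro exI conjI ballI allI)
  let ?h = "\<lambda>z. ((1 - fst z) * fst (snd z), \<lambda>i. (1 - fst z) * snd (snd z) i + fst z * a i)"
  have fst': "continuous_map (cylinder (cylinder (simplex_space n))) euclideanreal fst"
    "continuous_map (cylinder (cylinder (simplex_space n))) euclideanreal (\<lambda>z. fst (snd z))"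
    by (rule continuous_map_into_fulltopology[OF continuous_map_fst]
        continuous_map_into_fulltopology[OF continuous_map_compose[OF continuous_map_snd continuous_map_fst, unfolded o_def]])+
  have snd': "continuous_map (cylinder (cylinder (simplex_space n))) euclideanreal (\<lambda>z. snd (snd z) i)" for i
  proof -
    have "continuous_map (simplex_space n) euclideanreal (\<lambda>x. x i)"
      by (intro continuous_map_from_subtopology continuous_map_product_projection) simp
    from continuous_map_compose[OF continuous_map_compose[OF continuous_map_snd continuous_map_snd] this]
    show ?thesis by (simp add: o_def)
  qed
  show "continuous_map (cylinder (cylinder (simplex_space n))) (cylinder (simplex_space n)) ?h"
  proof (rule continuous_map_pairedI)
    show "continuous_map (cylinder (cylinder (simplex_space n))) (top_of_set {0..1}) (\<lambda>z. (1 - fst z) * fst (snd z))"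
      unfolding continuous_map_in_subtopology
      by (intro conjI continuous_map_real_mult continuous_map_diff fst' continuous_map_const[THEN iffD2])
        (auto intro!: mult_le_one)
    show "continuous_map (cylinder (cylinder (simplex_space n))) (simplex_space n)
       (\<lambda>z i. (1 - fst z) * snd (snd z) i + fst z * a i)"
      unfolding continuous_map_in_subtopology continuous_map_componentwise_UNIV
      by (intro conjI allI continuous_map_add continuous_map_real_mult continuous_map_diff fst' snd'
          continuous_map_const[THEN iffD2])
        (auto intro: convex_standard_simplex assms)
  qed
qed auto

text \<open>Contracting the cylinder makes a cycle homologous to a cycle in a one-point space, and
  in positive degree every such cycle is a boundary.\<close>

lemma singular_relboundary_cylinder:
  assumes "singular_relcycle p (cylinder (simplex_space n)) {} z" "p > 0"
  shows "singular_relboundary p (cylinder (simplex_space n)) {} z"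
proof -
  let ?Z = "cylinder (simplex_space n)"
  obtain a where a: "a \<in> standard_simplex n" using nonempty_standard_simplex by blast
  let ?c = "\<lambda>_. (0::real, a)"
  have "homologous_rel p ?Z {} (chain_map p id z) (chain_map p ?c z)"
    using homotopic_imp_homologous_rel_chain_maps[OF homotopic_with_cylinder_id_const[OF a] assms(1)] .
  moreover have "chain_map p id z = z"
    using assms(1) chain_map_ident singular_cycle by blast
  moreover have "singular_relboundary p ?Z {} (chain_map p ?c z)"
  proof -
    let ?P = "subtopology ?Z {(0, a)}"
    have top: "topspace ?P = {(0, a)}" using a by auto
    have "singular_relcycle p ?P {} (chain_map p ?c z)"
      using assms(1) by (rule singular_relcycle_chain_map) (use a in \<open>auto simp: continuous_map_const\<close>)
    then have "singular_relboundary p ?P {} (chain_map p ?c z)"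
      using singular_boundary_eq_cycle_singleton[OF top, of p] assms(2) by simp
    moreover have "continuous_map ?P ?Z id" by (simp add: continuous_map_from_subtopology)
    ultimately have "singular_relboundary p ?Z {} (chain_map p id (chain_map p ?c z))"
      using singular_relboundary_chain_map by blast
    moreover have "chain_map p id (chain_map p ?c z) = chain_map p ?c z"
      using \<open>singular_relcycle p ?P {} _\<close> chain_map_ident singular_cycle by blast
    ultimately show ?thesis by simp
  qed
  ultimately show ?thesis
    by (metis diff_add_cancel homologous_rel_def singular_relboundary_add)
qed

lemma continuous_map_Pair_cylinder:
  "u \<in> {0..1} \<Longrightarrow> continuous_map X (cylinder X) (Pair u)"
  by (intro continuous_map_pairedI) (auto simp: continuous_map_const)

text \<open>The boundary \<open>z\<close> prescribed for the new model is a cycle: the prism over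
  the boundary of the simplex has the difference of its two ends as boundary. Acyclicity of the
  cylinder then supplies a chain with boundary \<open>z\<close>.\<close>

lemma prism_model_step:
  assumes "prism_model p d' d" "p > 0 \<Longrightarrow> singular_chain p (cylinder (simplex_space (p - 1))) d'"
  shows "\<exists>e. prism_model (Suc p) d e"
proof -
  let ?u = "universal_simplex (Suc p)" and ?Z = "cylinder (simplex_space (Suc p))"
  let ?b = "chain_boundary (Suc p) ?u"
  define z where "z = chain_map (Suc p) (Pair 1) ?u - chain_map (Suc p) (Pair 0) ?u - prism_chain p d ?b"
  have d: "singular_chain (Suc p) (cylinder (simplex_space p)) d"
    using assms(1) by (simp add: prism_model_def)
  have u: "singular_chain (Suc p) (simplex_space (Suc p)) ?u"
    by (rule singular_chain_universal_simplex)
  then have b: "singular_chain p (simplex_space (Suc p)) ?b"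
    using singular_chain_boundary_alt by blast
  have "singular_chain (Suc p) ?Z z"
    unfolding z_def
    by (intro singular_chain_diff singular_chain_prism_chain[OF b d]
        singular_chain_chain_map[OF u] continuous_map_Pair_cylinder) auto
  moreover have "chain_boundary (Suc p) z = 0"
  proof -
    have "chain_boundary p ?b = 0"
      using chain_boundary_boundary_alt[OF u] .
    then have "chain_boundary (Suc p) (prism_chain p d ?b) = chain_map p (Pair 1) ?b - chain_map p (Pair 0) ?b"
      using chain_boundary_prism_chain[OF b assms] by (simp add: prism_chain_def)
    then show ?thesis
      using chain_boundary_chain_map[OF u, of "Pair (1::real)"] chain_boundary_chain_map[OF u, of "Pair (0::real)"]
      by (simp add: z_def chain_boundary_diff del: chain_map_of)
  qed
  ultimately have "singular_relcycle (Suc p) ?Z {} z"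
    by (simp add: singular_cycle)
  then have "singular_relboundary (Suc p) ?Z {} z"
    by (rule singular_relboundary_cylinder) simp
  then show ?thesis
    by (auto simp: singular_boundary prism_model_def z_def)
qed

text \<open>Acyclicity is available only in positive degrees, so dimension 0 is treated apart: the
  identity of the cylinder is a homotopy between its two end inclusions, which makes the two end
  points homologous.\<close>

lemma prism_model_0: "\<exists>d. prism_model 0 d' d"
proof -
  let ?Z = "cylinder (simplex_space 0)" and ?u = "universal_simplex 0"
  have "homotopic_with (\<lambda>h. h \<in> {} \<rightarrow> {}) (simplex_space 0) ?Z (Pair 0) (Pair (1::real))"
    unfolding homotopic_with_def
    by (intro exI[of _ id] conjI) (auto simp: case_prod_unfold)
  moreover have "singular_relcycle 0 (simplex_space 0) {} ?u"
    using singular_chain_universal_simplex[of 0] by (simp add: singular_cycle chain_boundary_def)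
  ultimately have "homologous_rel 0 ?Z {} (chain_map 0 (Pair 0) ?u) (chain_map 0 (Pair 1) ?u)"
    by (rule homotopic_imp_homologous_rel_chain_maps)
  then have "homologous_rel 0 ?Z {} (chain_map 0 (Pair 1) ?u) (chain_map 0 (Pair 0) ?u)"
    by (simp only: homologous_rel_sym)
  then show ?thesis
    by (auto simp: homologous_rel_def singular_boundary prism_model_def chain_boundary_def prism_chain_def simp del: chain_map_of)
qed

lemma prism_models_exist: "\<exists>d. \<forall>p. prism_model p (d (p - 1)) (d p)"
proof -
  \<comment> \<open>The invariant remembers the model one dimension below together with its chain
    condition, since both are needed to continue.\<close>
  let ?P = "\<lambda>p d. \<exists>d'. prism_model p d' d \<and> (p > 0 \<longrightarrow> singular_chain p (cylinder (simplex_space (p - 1))) d')"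
  have "\<exists>d. \<forall>p. ?P p (d p) \<and> prism_model (Suc p) (d p) (d (Suc p))"
  proof (rule dependent_nat_choice)
    show "\<exists>d. ?P 0 d" using prism_model_0 by blast
  next
    fix d p assume "?P p d"
    then obtain d' where d': "prism_model p d' d" "p > 0 \<Longrightarrow> singular_chain p (cylinder (simplex_space (p - 1))) d'"
      by blast
    then obtain e where "prism_model (Suc p) d e" using prism_model_step by blast
    moreover have "singular_chain (Suc p) (cylinder (simplex_space p)) d"
      using d' by (simp add: prism_model_def)
    ultimately show "\<exists>e. ?P (Suc p) e \<and> prism_model (Suc p) d e" by auto
  qed
  then obtain d where d: "\<And>p. ?P p (d p)" "\<And>p. prism_model (Suc p) (d p) (d (Suc p))" by blast
  have "prism_model p (d (p - 1)) (d p)" for p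
  proof (cases p)
    case 0
    \<comment> \<open>Here \<open>p - 1\<close> is \<open>0\<close> again, so the equation refers to
      \<open>d 0\<close> itself; the prism term vanishes because 0-chains have zero
      boundary.\<close>
    then show ?thesis using d(1)[of 0] by (auto simp: prism_model_def chain_boundary_def prism_chain_def)
  qed (use d(2) in auto)
  then show ?thesis by blast
qed

lemma natural_prism_exists:
  obtains P :: "nat \<Rightarrow> ((nat \<Rightarrow> real) \<Rightarrow> 'a) \<Rightarrow> (real \<times> 'a) chain"
  where "\<And>p X s. singular_simplex p X s \<Longrightarrow> singular_chain (Suc p) (cylinder X) (P p s)"
    and "\<And>p X s. singular_simplex p X s \<Longrightarrow> chain_boundary (Suc p) (P p s)
       = frag_of (simplex_map p (Pair 1) s) - frag_of (simplex_map p (Pair 0) s)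
         - frag_extend (P (p - 1)) (chain_boundary p (frag_of s))"
proof -
  obtain d where d: "\<And>p. prism_model p (d (p - 1)) (d p)" using prism_models_exist by blast
  then have chain: "singular_chain (Suc p) (cylinder (simplex_space p)) (d p)" for p
    by (simp add: prism_model_def)
  let ?P = "\<lambda>p s. chain_map (Suc p) (map_prod id s) (d p)"
  have P: "frag_extend (?P p) = prism_chain p (d p)" for p
    by (simp add: prism_chain_def)
  show thesis
  proof (rule that[of ?P])
    fix p X and s :: "(nat \<Rightarrow> real) \<Rightarrow> 'a" assume "singular_simplex p X s"
    then have s: "singular_chain p X (frag_of s)" by (simp add: singular_chain_of)
    show "singular_chain (Suc p) (cylinder X) (?P p s)"
      using singular_chain_prism_chain[OF s chain] by (simp add: prism_chain_def)
    have "p > 0 \<Longrightarrow> singular_chain p (cylinder (simplex_space (p - 1))) (d (p - 1))"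
      using chain[of "p - 1"] by simp
    from chain_boundary_prism_chain[OF s d this]
    show "chain_boundary (Suc p) (?P p s) = frag_of (simplex_map p (Pair 1) s) - frag_of (simplex_map p (Pair 0) s)
         - frag_extend (?P (p - 1)) (chain_boundary p (frag_of s))"
      unfolding P by (simp add: prism_chain_def)
  qed
qed

text \<open>Applied to the integral boundary of a simplex, this turns the integral prism over it
  into the prism with coefficients over \<open>coeff_boundary\<close>.\<close>

lemma chain_tensor_frag_extend:
  "chain_tensor g (frag_extend F c) = chain_extend (\<lambda>s h. chain_tensor h (F s)) (chain_tensor g c)"
proof -
  have add: "Modules.additive (chain_extend (\<lambda>s h. chain_tensor h (F s)))"
    by (rule additive_chain_extend, rule additive_chain_tensor_left)
  show ?thesis
    using subset_UNIV
  proof (induction c rule: frag_induction)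
    case (diff a b)
    then show ?case
      by (simp add: frag_extend_diff additive.diff[OF additive_chain_tensor] additive.diff[OF add])
  qed (simp_all add: additive.zero[OF additive_chain_tensor] additive.zero[OF add]
      chain_extend_single additive_chain_tensor_left)
qed

text \<open>With \<open>Q\<close> the prism operator with coefficients and \<open>h\<close> the
  homotopy, the image of \<open>Q p c\<close> under \<open>h\<close> has the required difference as
  boundary, because the prism over the boundary of a cycle vanishes.\<close>

theorem coeff_homotopy_invariance:
  fixes c :: "('a, 'g::ab_group_add) coeff_chain"
  assumes "homotopic_with (\<lambda>_. True) X Y f g" "c \<in> coeff_cycles p X"
  shows "coeff_chain_map p g c - coeff_chain_map p f c \<in> coeff_boundaries p Y"
proof -
  obtain h where h: "continuous_map (cylinder X) Y h" "\<And>x. h (0, x) = f x" "\<And>x. h (1, x) = g x"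
    using assms(1) by (auto simp: homotopic_with_def)
  obtain P :: "nat \<Rightarrow> ((nat \<Rightarrow> real) \<Rightarrow> 'a) \<Rightarrow> (real \<times> 'a) chain"
    where P: "\<And>p X s. singular_simplex p X s \<Longrightarrow> singular_chain (Suc p) (cylinder X) (P p s)"
    and bd: "\<And>p X s. singular_simplex p X s \<Longrightarrow> chain_boundary (Suc p) (P p s)
       = frag_of (simplex_map p (Pair 1) s) - frag_of (simplex_map p (Pair 0) s)
         - frag_extend (P (p - 1)) (chain_boundary p (frag_of s))"
    by (rule natural_prism_exists) blast
  define Q where "Q p = chain_extend (\<lambda>s h::'g. chain_tensor h (P p s))" for p
  have addQ: "Modules.additive (Q p)" for p
    unfolding Q_def by (rule additive_chain_extend, rule additive_chain_tensor_left)
  have c: "c \<in> coeff_chains p X" "coeff_boundary p c = 0"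
    using assms(2) by (auto simp: coeff_cycles_def)
  have Qc: "Q p c \<in> coeff_chains (Suc p) (cylinder X)"
    unfolding Q_def using c(1) by (rule coeff_chains_extend) (auto intro: chain_tensor_in_chains P)
  have "coeff_boundary (Suc p) (Q p c)
      = coeff_chain_map p (Pair 1) c - coeff_chain_map p (Pair 0) c - Q (p - 1) (coeff_boundary p c)"
  proof (rule additive_eqI[where c = c])
    show "Modules.additive (\<lambda>c. coeff_boundary (Suc p) (Q p c))"
      by (rule additive_comp[OF additive_coeff_boundary addQ])
    show "Modules.additive (\<lambda>c. coeff_chain_map p (Pair 1) c - coeff_chain_map p (Pair 0) c - Q (p - 1) (coeff_boundary p c))"
      by (rule additive_minus[OF additive_minus[OF additive_coeff_chain_map additive_coeff_chain_map]
            additive_comp[OF addQ additive_coeff_boundary]])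
  next
    \<comment> \<open>On one-term chains the formula is the integral prism formula tensored with
      \<open>a\<close>.\<close>
    fix s and a :: 'g assume "s \<in> Poly_Mapping.keys c"
    then have s: "singular_simplex p X s" using c(1) by (auto simp: coeff_chains_def)
    have "Q p (Poly_Mapping.single s a) = chain_tensor a (P p s)"
      unfolding Q_def by (simp add: chain_extend_single additive_chain_tensor_left)
    moreover have "Q (p - 1) (coeff_boundary p (Poly_Mapping.single s a))
        = chain_tensor a (frag_extend (P (p - 1)) (chain_boundary p (frag_of s)))"
      unfolding Q_def by (simp add: coeff_boundary_single chain_tensor_frag_extend)
    ultimately show "coeff_boundary (Suc p) (Q p (Poly_Mapping.single s a)) =
       coeff_chain_map p (Pair 1) (Poly_Mapping.single s a) - coeff_chain_map p (Pair 0) (Poly_Mapping.single s a)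
         - Q (p - 1) (coeff_boundary p (Poly_Mapping.single s a))"
      by (simp add: coeff_boundary_tensor bd[OF s] additive.diff[OF additive_chain_tensor])
  qed
  then have "coeff_boundary (Suc p) (Q p c) = coeff_chain_map p (Pair 1) c - coeff_chain_map p (Pair 0) c"
    by (simp add: c additive.zero[OF addQ])
  then have "coeff_boundary (Suc p) (coeff_chain_map (Suc p) h (Q p c))
     = coeff_chain_map p h (coeff_chain_map p (Pair 1) c) - coeff_chain_map p h (coeff_chain_map p (Pair 0) c)"
    using coeff_boundary_chain_map[OF Qc, of h] by (simp add: additive.diff[OF additive_coeff_chain_map])
  also have "\<dots> = coeff_chain_map p g c - coeff_chain_map p f c"
    by (simp add: coeff_chain_map_compose[symmetric] o_def h)
  finally show ?thesis
    unfolding coeff_boundaries_def using coeff_chain_map_in_chains[OF Qc h(1)] by (metis imageI)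
qed

section \<open>Homology classes\<close>

lemma zero_in_coeff_boundaries: "0 \<in> coeff_boundaries p X"
  unfolding coeff_boundaries_def
  by (rule image_eqI[of _ _ 0]) (simp_all add: additive.zero[OF additive_coeff_boundary] coeff_chains_0)

lemma coeff_boundaries_diff:
  "a \<in> coeff_boundaries p X \<Longrightarrow> b \<in> coeff_boundaries p X \<Longrightarrow> a - b \<in> coeff_boundaries p X"
  unfolding coeff_boundaries_def
  by (auto simp: additive.diff[OF additive_coeff_boundary, symmetric] intro: coeff_chains_diff)

lemma coeff_boundaries_minus: "a \<in> coeff_boundaries p X \<Longrightarrow> - a \<in> coeff_boundaries p X"
  using coeff_boundaries_diff[OF zero_in_coeff_boundaries] by fastforce

lemma coeff_boundaries_add:
  "a \<in> coeff_boundaries p X \<Longrightarrow> b \<in> coeff_boundaries p X \<Longrightarrow> a + b \<in> coeff_boundaries p X"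
  using coeff_boundaries_diff[OF _ coeff_boundaries_minus] by fastforce

lemma coeff_cycles_diff: "a \<in> coeff_cycles p X \<Longrightarrow> b \<in> coeff_cycles p X \<Longrightarrow> a - b \<in> coeff_cycles p X"
  by (simp add: coeff_cycles_def coeff_chains_diff additive.diff[OF additive_coeff_boundary])

lemma coeff_cycles_chain_map:
  "c \<in> coeff_cycles p X \<Longrightarrow> continuous_map X Y f \<Longrightarrow> coeff_chain_map p f c \<in> coeff_cycles p Y"
  by (auto simp: coeff_cycles_def coeff_chain_map_in_chains coeff_boundary_chain_map
      additive.zero[OF additive_coeff_chain_map])

lemma coeff_boundaries_chain_map:
  assumes "c \<in> coeff_boundaries p X" "continuous_map X Y f"
  shows "coeff_chain_map p f c \<in> coeff_boundaries p Y"
proof -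
  obtain d where d: "d \<in> coeff_chains (Suc p) X" "c = coeff_boundary (Suc p) d"
    using assms(1) by (auto simp: coeff_boundaries_def)
  then have "coeff_chain_map p f c = coeff_boundary (Suc p) (coeff_chain_map (Suc p) f d)"
    using coeff_boundary_chain_map[OF d(1), of f] by simp
  then show ?thesis
    using coeff_chain_map_in_chains[OF d(1) assms(2)] by (auto simp: coeff_boundaries_def)
qed

definition coeff_class :: "nat \<Rightarrow> 'a topology \<Rightarrow> ('a, 'g::ab_group_add) coeff_chain \<Rightarrow> ('a, 'g) coeff_chain set" where
  "coeff_class p X c = coeff_boundaries p X #>\<^bsub>coeff_cycle_group p X\<^esub> c"

lemma mem_coeff_class: "d \<in> coeff_class p X c \<longleftrightarrow> d - c \<in> coeff_boundaries p X"
  by (auto simp: coeff_class_def r_coset_def coeff_cycle_group_def intro!: bexI[of _ "d - c"])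

lemma coeff_class_eq_iff: "coeff_class p X c = coeff_class p X d \<longleftrightarrow> c - d \<in> coeff_boundaries p X"
proof
  assume "coeff_class p X c = coeff_class p X d"
  moreover have "c \<in> coeff_class p X c" by (simp add: mem_coeff_class zero_in_coeff_boundaries)
  ultimately have "c \<in> coeff_class p X d" by simp
  then show "c - d \<in> coeff_boundaries p X" by (simp add: mem_coeff_class)
next
  assume cd: "c - d \<in> coeff_boundaries p X"
  have "e - c \<in> coeff_boundaries p X \<longleftrightarrow> e - d \<in> coeff_boundaries p X" for e
    using coeff_boundaries_add[OF _ cd, of "e - c"] coeff_boundaries_diff[OF _ cd, of "e - d"] by auto
  then show "coeff_class p X c = coeff_class p X d"
    by (intro Set.set_eqI) (simp add: mem_coeff_class)
qed

lemma carrier_coeff_homology_group: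
  "carrier (coeff_homology_group G p X) = coeff_class p X ` coeff_cycles p X"
  by (auto simp: coeff_homology_group_def FactGroup_def RCOSETS_def coeff_class_def coeff_cycle_group_def)

lemma mult_coeff_homology_group:
  "coeff_class p X c \<otimes>\<^bsub>coeff_homology_group G p X\<^esub> coeff_class p X d = coeff_class p X (c + d)"
proof -
  have "coeff_class p X c \<otimes>\<^bsub>coeff_homology_group G p X\<^esub> coeff_class p X d
      = {a + b | a b. a \<in> coeff_class p X c \<and> b \<in> coeff_class p X d}"
    by (auto simp: coeff_homology_group_def FactGroup_def set_mult_def coeff_cycle_group_def)
  also have "\<dots> = coeff_class p X (c + d)"
  proof (intro Set.set_eqI iffI)
    fix e assume "e \<in> coeff_class p X (c + d)"
    then have "e - d \<in> coeff_class p X c" "d \<in> coeff_class p X d"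
      by (simp_all add: mem_coeff_class diff_diff_eq add.commute zero_in_coeff_boundaries)
    then show "e \<in> {a + b | a b. a \<in> coeff_class p X c \<and> b \<in> coeff_class p X d}"
      by (metis (mono_tags, lifting) diff_add_cancel mem_Collect_eq)
  next
    fix e assume "e \<in> {a + b | a b. a \<in> coeff_class p X c \<and> b \<in> coeff_class p X d}"
    then obtain a b where "e = a + b" "a - c \<in> coeff_boundaries p X" "b - d \<in> coeff_boundaries p X"
      by (auto simp: mem_coeff_class)
    then show "e \<in> coeff_class p X (c + d)"
      using coeff_boundaries_add[of "a - c" p X "b - d"] by (simp add: mem_coeff_class algebra_simps)
  qed
  finally show ?thesis .
qed

lemma coeff_hom_induced_class:
  assumes "continuous_map X Y f"
  shows "coeff_hom_induced G p Y f (coeff_class p X c) = coeff_class p Y (coeff_chain_map p f c)"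
proof -
  have "coeff_class p Y (coeff_chain_map p f d) = coeff_class p Y (coeff_chain_map p f c)"
    if "d \<in> coeff_class p X c" for d
    using coeff_boundaries_chain_map[OF that[unfolded mem_coeff_class] assms]
    by (simp add: coeff_class_eq_iff additive.diff[OF additive_coeff_chain_map])
  moreover have "c \<in> coeff_class p X c"
    by (simp add: mem_coeff_class zero_in_coeff_boundaries)
  ultimately show ?thesis
    unfolding coeff_hom_induced_def coeff_class_def[symmetric] by (intro SUP_eq_const) blast+
qed

text \<open>Injectivity holds because \<open>q \<circ> s\<close> is homotopic to the identity. As
  \<open>s\<close> maps into \<open>K\<close>, its classes in \<open>L\<close> lie in the image;
  conversely a cycle of \<open>K\<close> is homologous in \<open>L\<close> to what \<open>s\<close>
  makes of its image under \<open>q\<close>. So the second homotopy only has to start on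
  \<open>K\<close> and may use all of \<open>L\<close>.\<close>

lemma coeff_homology_iso_image:
  fixes s :: "'a \<Rightarrow> 'b" and q :: "'b \<Rightarrow> 'a"
  assumes s: "continuous_map X K s" and i: "continuous_map K L id" and q: "continuous_map L X q"
    and qs: "homotopic_with (\<lambda>_. True) X X (q \<circ> s) id"
    and sq: "homotopic_with (\<lambda>_. True) K L (s \<circ> q) id"
  shows "coeff_homology_group TYPE('g::ab_group_add) p X \<cong>
    (coeff_homology_group TYPE('g) p L)
      \<lparr>carrier := coeff_hom_induced TYPE('g) p L id ` carrier (coeff_homology_group TYPE('g) p K)\<rparr>"
    (is "?H \<cong> ?I")
proof -
  note add = additive_coeff_chain_map
  have sL: "continuous_map X L s" using continuous_map_compose[OF s i] by simp
  have qK: "continuous_map K X q" using continuous_map_compose[OF i q] by simp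
  have id_K: "coeff_chain_map p id c = c" if "c \<in> coeff_cycles p K" for c :: "('b, 'g) coeff_chain"
    using that by (intro coeff_chain_map_ident[of _ _ K]) (auto simp: coeff_cycles_def)
  have id_X: "coeff_chain_map p id c = c" if "c \<in> coeff_cycles p X" for c :: "('a, 'g) coeff_chain"
    using that by (intro coeff_chain_map_ident[of _ _ X]) (auto simp: coeff_cycles_def)
  let ?f = "coeff_hom_induced TYPE('g) p L s"
  have f: "?f (coeff_class p X c) = coeff_class p L (coeff_chain_map p s c)" for c
    by (rule coeff_hom_induced_class[OF sL])
  have carI: "carrier ?I = coeff_class p L ` coeff_cycles p K"
    by (auto simp: carrier_coeff_homology_group image_image coeff_hom_induced_class[OF i] id_K)
  have "?f \<in> iso ?H ?I"
  proof (rule isoI)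
    show "?f \<in> hom ?H ?I"
    proof (rule homI)
      fix x assume "x \<in> carrier ?H"
      then show "?f x \<in> carrier ?I"
        unfolding carI by (auto simp: carrier_coeff_homology_group f coeff_cycles_chain_map[OF _ s])
    next
      fix x y assume "x \<in> carrier ?H" "y \<in> carrier ?H"
      then show "?f (x \<otimes>\<^bsub>?H\<^esub> y) = ?f x \<otimes>\<^bsub>?I\<^esub> ?f y"
        by (auto simp: carrier_coeff_homology_group f mult_coeff_homology_group additive.add[OF add])
    qed
    show "bij_betw ?f (carrier ?H) (carrier ?I)"
    proof (rule bij_betwI')
      fix x y assume "x \<in> carrier ?H" "y \<in> carrier ?H"
      then obtain c d where c: "c \<in> coeff_cycles p X" "x = coeff_class p X c"
        and d: "d \<in> coeff_cycles p X" "y = coeff_class p X d"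
        by (auto simp: carrier_coeff_homology_group)
      have cd: "c - d \<in> coeff_cycles p X" using c d by (simp add: coeff_cycles_diff)
      show "?f x = ?f y \<longleftrightarrow> x = y"
      proof
        assume "?f x = ?f y"
        then have "coeff_chain_map p s (c - d) \<in> coeff_boundaries p L"
          by (simp add: c d f coeff_class_eq_iff additive.diff[OF add])
        then have "coeff_chain_map p (q \<circ> s) (c - d) \<in> coeff_boundaries p X"
          unfolding coeff_chain_map_compose using q by (rule coeff_boundaries_chain_map)
        from coeff_boundaries_add[OF coeff_homotopy_invariance[OF qs cd] this]
        show "x = y" by (simp add: id_X[OF cd] c d coeff_class_eq_iff)
      qed simp
    next
      fix x assume "x \<in> carrier ?H"
      then show "?f x \<in> carrier ?I"
        unfolding carI by (auto simp: carrier_coeff_homology_group f coeff_cycles_chain_map[OF _ s])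
    next
      fix y assume "y \<in> carrier ?I"
      then obtain c where c: "c \<in> coeff_cycles p K" "y = coeff_class p L c"
        unfolding carI by auto
      have "coeff_chain_map p id c - coeff_chain_map p (s \<circ> q) c \<in> coeff_boundaries p L"
        by (rule coeff_homotopy_invariance[OF sq c(1)])
      then have "y = ?f (coeff_class p X (coeff_chain_map p q c))"
        by (simp add: c f id_K coeff_class_eq_iff coeff_chain_map_compose)
      then show "\<exists>x\<in>carrier ?H. y = ?f x"
        using coeff_cycles_chain_map[OF c(1) qK] by (auto simp: carrier_coeff_homology_group)
    qed
  qed
  then show ?thesis by (auto simp: is_iso_def)
qed

section \<open>Maps into and out of geometric realizations\<close>

definition simplicial_complex :: "'v set set \<Rightarrow> bool" where
  "simplicial_complex K \<longleftrightarrow> (\<forall>\<sigma>\<in>K. finite \<sigma> \<and> (\<forall>\<rho>\<subseteq>\<sigma>. \<rho> \<in> K))"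

definition supp :: "('v \<Rightarrow> real) \<Rightarrow> 'v set" where
  "supp t = {v. t v \<noteq> 0}"

definition barycentric :: "('v \<Rightarrow> real) \<Rightarrow> bool" where
  "barycentric t \<longleftrightarrow> finite (supp t) \<and> (\<forall>v. 0 \<le> t v) \<and> sum t (supp t) = 1"

lemma mem_geometric_cell_iff:
  assumes "finite \<sigma>"
  shows "t \<in> geometric_cell \<sigma> \<longleftrightarrow> barycentric t \<and> supp t \<subseteq> \<sigma>"
proof (cases "supp t \<subseteq> \<sigma>")
  case True
  moreover have "sum t \<sigma> = sum t (supp t)"
    by (rule sum.mono_neutral_right) (use assms True in \<open>auto simp: supp_def\<close>)
  ultimately show ?thesis
    using assms by (auto simp: geometric_cell_def barycentric_def supp_def finite_subset)
qed (auto simp: geometric_cell_def supp_def)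

lemma supp_subset_of_cell: "t \<in> geometric_cell \<sigma> \<Longrightarrow> supp t \<subseteq> \<sigma>"
  by (auto simp: geometric_cell_def supp_def)

lemma subtopology_powertop_real: "subtopology (powertop_real UNIV) S = top_of_set S"
  by (simp add: euclidean_product_topology)

lemma closed_geometric_cell: "closed (geometric_cell \<sigma>)"
proof -
  have "geometric_cell \<sigma> = (\<Inter>v. {t. 0 \<le> t v}) \<inter> (\<Inter>v\<in>-\<sigma>. {t. t v = 0}) \<inter> {t. (\<Sum>v\<in>\<sigma>. t v) = 1}"
    by (auto simp: geometric_cell_def)
  also have "closed \<dots>"
    by (intro closed_Int closed_INT closed_Collect_le closed_Collect_eq ballI continuous_intros
        continuous_on_product_coordinates)
  finally show ?thesis .
qed

lemma continuous_map_from_realization: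
  assumes "\<And>\<sigma>. \<sigma> \<in> K \<Longrightarrow> continuous_map (top_of_set (geometric_cell \<sigma>)) Y f"
  shows "continuous_map (geometric_realization K) Y f"
  unfolding continuous_map_def
proof (intro conjI allI impI)
  show "f \<in> topspace (geometric_realization K) \<rightarrow> topspace Y"
    using assms by (fastforce simp: topspace_geometric_realization continuous_map_def)
  fix U assume U: "openin Y U"
  have "openin (top_of_set (geometric_cell \<sigma>)) ({x \<in> topspace (geometric_realization K). f x \<in> U} \<inter> geometric_cell \<sigma>)"
    if "\<sigma> \<in> K" for \<sigma>
  proof -
    have "{x \<in> topspace (geometric_realization K). f x \<in> U} \<inter> geometric_cell \<sigma> = {x \<in> geometric_cell \<sigma>. f x \<in> U}"
      using that by (auto simp: topspace_geometric_realization)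
    then show ?thesis using assms[OF that] U by (auto simp: continuous_map_def)
  qed
  then show "openin (geometric_realization K) {x \<in> topspace (geometric_realization K). f x \<in> U}"
    unfolding openin_geometric_realization subtopology_powertop_real
    by (auto simp: topspace_geometric_realization)
qed

text \<open>Continuity of the coordinates only concerns the product topology, while the coherent one
  may be finer. Near a point finitely many vertices occur, hence finitely many cells, and on them
  the complement of an open set is a finite union of closed sets.\<close>

lemma continuous_map_into_realization:
  fixes g :: "'z::topological_space \<Rightarrow> 'v \<Rightarrow> real"
  assumes L: "\<And>\<sigma>. \<sigma> \<in> L \<Longrightarrow> finite \<sigma>"
    and cont: "\<And>v. continuous_on Z (\<lambda>z. g z v)"
    and mem: "\<And>z. z \<in> Z \<Longrightarrow> barycentric (g z) \<and> supp (g z) \<in> L"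
    and locfin: "\<And>z. z \<in> Z \<Longrightarrow> \<exists>N. open N \<and> z \<in> N \<and> finite (\<Union>z'\<in>Z \<inter> N. supp (g z'))"
  shows "continuous_map (top_of_set Z) (geometric_realization L) g"
  unfolding continuous_map_def
proof (intro conjI allI impI)
  show "g \<in> topspace (top_of_set Z) \<rightarrow> topspace (geometric_realization L)"
    using mem L by (fastforce simp: topspace_geometric_realization mem_geometric_cell_iff)
  fix U assume U: "openin (geometric_realization L) U"
  have contg: "continuous_on Z g" by (rule continuous_on_coordinatewise_then_product[OF cont])
  show "openin (top_of_set Z) {x \<in> topspace (top_of_set Z). g x \<in> U}"
  proof (subst openin_subopen, intro ballI)
    fix z assume z: "z \<in> {x \<in> topspace (top_of_set Z). g x \<in> U}"
    then obtain N where N: "open N" "z \<in> N" "finite (\<Union>z'\<in>Z \<inter> N. supp (g z'))"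
      using locfin by auto
    define F where "F = {\<sigma>\<in>L. \<sigma> \<subseteq> (\<Union>z'\<in>Z \<inter> N. supp (g z'))}"
    define C where "C = (\<Union>\<sigma>\<in>F. geometric_cell \<sigma> - U)"
    have "finite F" using N(3) by (auto simp: F_def intro: finite_subset[of _ "Pow _"])
    moreover have "closed (geometric_cell \<sigma> - U)" if "\<sigma> \<in> F" for \<sigma>
    proof -
      have "openin (top_of_set (geometric_cell \<sigma>)) (U \<inter> geometric_cell \<sigma>)"
        using U that by (simp add: openin_geometric_realization subtopology_powertop_real F_def)
      then have "closedin (top_of_set (geometric_cell \<sigma>)) (geometric_cell \<sigma> - U)"
        by (simp add: closedin_def Diff_Diff_Int Int_commute)
      then show ?thesis using closed_geometric_cell closedin_closed_trans by blast
    qed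
    ultimately have "closed C" unfolding C_def by blast
    then obtain W where W: "open W" "Z \<inter> g -` (- C) = Z \<inter> W"
      using continuous_on_open_invariant[THEN iffD1, OF contg] by (metis Int_commute open_Compl)
    have C: "g z' \<in> U \<longleftrightarrow> g z' \<notin> C" if "z' \<in> Z" "z' \<in> N" for z'
    proof -
      have "g z' \<in> geometric_cell (supp (g z'))" "supp (g z') \<in> F"
        using mem[OF that(1)] L that by (auto simp: mem_geometric_cell_iff F_def)
      then show ?thesis by (auto simp: C_def)
    qed
    show "\<exists>T. openin (top_of_set Z) T \<and> z \<in> T \<and> T \<subseteq> {x \<in> topspace (top_of_set Z). g x \<in> U}"
    proof (intro exI conjI)
      show "openin (top_of_set Z) (Z \<inter> (N \<inter> W))"
        using N(1) W(1) by (simp add: openin_open_Int open_Int)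
      show "z \<in> Z \<inter> (N \<inter> W)" using z N C W(2) by auto
      show "Z \<inter> (N \<inter> W) \<subseteq> {x \<in> topspace (top_of_set Z). g x \<in> U}" using C W(2) by auto
    qed
  qed
qed

text \<open>The interval is compact, so the tube lemma makes the product of the realization with it
  again coherent with the cells.\<close>

lemma continuous_map_from_realization_cylinder:
  assumes "\<And>\<sigma>. \<sigma> \<in> K \<Longrightarrow> continuous_map (top_of_set ({0..1::real} \<times> geometric_cell \<sigma>)) Y h"
  shows "continuous_map (prod_topology (top_of_set {0..1}) (geometric_realization K)) Y h"
  unfolding continuous_map_def
proof (intro conjI allI impI)
  let ?Z = "prod_topology (top_of_set {0..1::real}) (geometric_realization K)"
  show "h \<in> topspace ?Z \<rightarrow> topspace Y"
    using assms by (fastforce simp: topspace_geometric_realization continuous_map_def)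
  fix U assume U: "openin Y U"
  show "openin ?Z {x \<in> topspace ?Z. h x \<in> U}"
  proof (subst openin_subopen, intro ballI)
    fix z assume "z \<in> {x \<in> topspace ?Z. h x \<in> U}"
    then obtain u t \<sigma>\<^sub>0 where z: "z = (u, t)" "u \<in> {0..1}" "h (u, t) \<in> U" "\<sigma>\<^sub>0 \<in> K" "t \<in> geometric_cell \<sigma>\<^sub>0"
      by (auto simp: topspace_geometric_realization)
    have opn: "\<exists>W. open W \<and> {x \<in> {0..1} \<times> geometric_cell \<sigma>. h x \<in> U} = ({0..1} \<times> geometric_cell \<sigma>) \<inter> W"
      if "\<sigma> \<in> K" for \<sigma>
      using assms[OF that] U by (simp add: continuous_map_def openin_open)
    obtain W where W: "open W" "{x \<in> {0..1} \<times> geometric_cell \<sigma>\<^sub>0. h x \<in> U} = ({0..1} \<times> geometric_cell \<sigma>\<^sub>0) \<inter> W"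
      using opn[OF z(4)] by blast
    with z have "(u, t) \<in> W" by auto
    with W(1) obtain A B where AB: "open A" "open B" "u \<in> A" "t \<in> B" "A \<times> B \<subseteq> W"
      by (metis mem_Sigma_iff open_prod_elim)
    obtain \<delta> where \<delta>: "\<delta> > 0" "cball u \<delta> \<subseteq> A"
      using AB(1,3) open_contains_cball by blast
    define J where "J = {0..1} \<inter> cball u \<delta>"
    have "compact J" by (simp add: J_def compact_Int)
    define V where "V = {s \<in> topspace (geometric_realization K). \<forall>v\<in>J. h (v, s) \<in> U}"
    have "t \<in> V"
    proof -
      have "h (v, t) \<in> U" if "v \<in> J" for v
      proof -
        have "(v, t) \<in> ({0..1} \<times> geometric_cell \<sigma>\<^sub>0) \<inter> W"
          using that \<delta>(2) AB z by (auto simp: J_def)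
        then show ?thesis using W(2) by auto
      qed
      then show ?thesis using z by (auto simp: V_def topspace_geometric_realization)
    qed
    have "openin (geometric_realization K) V"
    proof -
      have "openin (top_of_set (geometric_cell \<sigma>)) (V \<inter> geometric_cell \<sigma>)" if "\<sigma> \<in> K" for \<sigma>
      proof -
        from opn[OF that] obtain W
          where W: "open W" "{x \<in> {0..1} \<times> geometric_cell \<sigma>. h x \<in> U} = ({0..1} \<times> geometric_cell \<sigma>) \<inter> W"
          by blast
        let ?C = "(J \<times> geometric_cell \<sigma>) - W"
        have "closedin (top_of_set (J \<times> geometric_cell \<sigma>)) ?C"
          using W(1) by (simp add: closedin_diff openin_open_Int closedin_def Diff_Diff_Int)
        then have "closedin (top_of_set (geometric_cell \<sigma>)) (snd ` ?C)"
          using Abstract_Topological_Spaces.closed_map_snd[of "top_of_set J" "top_of_set (geometric_cell \<sigma>)"] \<open>compact J\<close>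
          by (simp add: closed_map_def compact_space_subtopology)
        moreover have "V \<inter> geometric_cell \<sigma> = geometric_cell \<sigma> - snd ` ?C"
        proof -
          have "h (v, s) \<in> U \<longleftrightarrow> (v, s) \<in> W" if "v \<in> J" "s \<in> geometric_cell \<sigma>" for v s
            using W(2) that by (auto simp: J_def set_eq_iff)
          then show ?thesis
            using that by (force simp: V_def topspace_geometric_realization)
        qed
        ultimately show ?thesis by (simp add: openin_diff)
      qed
      then show ?thesis
        unfolding openin_geometric_realization subtopology_powertop_real
        by (auto simp: V_def topspace_geometric_realization)
    qed
    moreover have "openin (top_of_set {0..1}) ({0..1} \<inter> ball u \<delta>)"
      by (simp add: openin_open_Int)
    ultimately have "openin ?Z (({0..1} \<inter> ball u \<delta>) \<times> V)"
      by (simp add: openin_prod_Times_iff)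
    moreover have "z \<in> ({0..1} \<inter> ball u \<delta>) \<times> V"
      using z \<delta>(1) \<open>t \<in> V\<close> by auto
    moreover have "({0..1} \<inter> ball u \<delta>) \<times> V \<subseteq> {x \<in> topspace ?Z. h x \<in> U}"
      by (auto simp: V_def J_def)
    ultimately show "\<exists>T. openin ?Z T \<and> z \<in> T \<and> T \<subseteq> {x \<in> topspace ?Z. h x \<in> U}" by blast
  qed
qed

lemma barycentric_convex:
  assumes "barycentric s" "barycentric t" "0 \<le> u" "u \<le> 1"
  shows "barycentric (\<lambda>v. (1 - u) * s v + u * t v)"
proof -
  let ?F = "supp s \<union> supp t" and ?h = "\<lambda>v. (1 - u) * s v + u * t v"
  have fin: "finite ?F" using assms by (simp add: barycentric_def)
  have "s \<in> geometric_cell ?F" "t \<in> geometric_cell ?F"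
    using assms fin by (auto simp: mem_geometric_cell_iff)
  then have "?h \<in> geometric_cell ?F"
    using assms(3,4) by (auto simp: geometric_cell_def sum.distrib simp flip: sum_distrib_left)
  then show ?thesis using fin mem_geometric_cell_iff by blast
qed

text \<open>The union of the two supports is a simplex, so the segment from \<open>f t\<close> to
  \<open>g t\<close> stays in its cell. Continuity is tested over one cell of \<open>K\<close> at a
  time, which is why \<open>locfin\<close> is stated relative to a cell.\<close>

lemma homotopic_realization_straight_line:
  fixes f g :: "('v \<Rightarrow> real) \<Rightarrow> 'w \<Rightarrow> real"
  assumes K: "\<And>\<sigma>. \<sigma> \<in> K \<Longrightarrow> finite \<sigma>" and L: "simplicial_complex L"
    and bary: "\<And>\<sigma> t. \<sigma> \<in> K \<Longrightarrow> t \<in> geometric_cell \<sigma> \<Longrightarrow> barycentric (f t) \<and> barycentric (g t)"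
    and cont: "\<And>\<sigma> w. \<sigma> \<in> K \<Longrightarrow> continuous_on (geometric_cell \<sigma>) (\<lambda>t. f t w)"
      "\<And>\<sigma> w. \<sigma> \<in> K \<Longrightarrow> continuous_on (geometric_cell \<sigma>) (\<lambda>t. g t w)"
    and simplex: "\<And>\<sigma> t. \<sigma> \<in> K \<Longrightarrow> t \<in> geometric_cell \<sigma> \<Longrightarrow> supp (f t) \<union> supp (g t) \<in> L"
    and locfin: "\<And>\<sigma> t. \<sigma> \<in> K \<Longrightarrow> t \<in> geometric_cell \<sigma> \<Longrightarrow>
      \<exists>N. open N \<and> t \<in> N \<and> finite (\<Union>t'\<in>geometric_cell \<sigma> \<inter> N. supp (f t') \<union> supp (g t'))"
  shows "homotopic_with (\<lambda>_. True) (geometric_realization K) (geometric_realization L) f g"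
  unfolding homotopic_with_def
proof (intro exI conjI ballI allI)
  let ?h = "\<lambda>z w. (1 - fst z) * f (snd z) w + fst z * g (snd z) w"
  have supp_h: "supp (?h z) \<subseteq> supp (f (snd z)) \<union> supp (g (snd z))" for z
    by (auto simp: supp_def)
  show "continuous_map (prod_topology (top_of_set {0..1}) (geometric_realization K)) (geometric_realization L) ?h"
  proof (rule continuous_map_from_realization_cylinder, rule continuous_map_into_realization)
    fix \<sigma> assume \<sigma>: "\<sigma> \<in> K"
    show "continuous_on ({0..1} \<times> geometric_cell \<sigma>) (\<lambda>z. ?h z w)" for w
      by (intro continuous_intros continuous_on_compose2[OF cont(1)[OF \<sigma>]]
          continuous_on_compose2[OF cont(2)[OF \<sigma>]]) auto
    fix z :: "real \<times> ('v \<Rightarrow> real)" assume z: "z \<in> {0..1} \<times> geometric_cell \<sigma>"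
    have "supp (f (snd z)) \<union> supp (g (snd z)) \<in> L"
      using simplex[OF \<sigma>] z by auto
    then have "supp (?h z) \<in> L" using L supp_h[of z] unfolding simplicial_complex_def by blast
    moreover have "barycentric (?h z)"
      using z bary[OF \<sigma>] by (auto intro: barycentric_convex)
    ultimately show "barycentric (?h z) \<and> supp (?h z) \<in> L" by blast
    obtain N where N: "open N" "snd z \<in> N" "finite (\<Union>t'\<in>geometric_cell \<sigma> \<inter> N. supp (f t') \<union> supp (g t'))"
      using locfin[OF \<sigma>, of "snd z"] z by auto
    show "\<exists>N. open N \<and> z \<in> N \<and> finite (\<Union>z'\<in>({0..1} \<times> geometric_cell \<sigma>) \<inter> N. supp (?h z'))"
    proof (intro exI conjI)
      show "open (UNIV \<times> N)" "z \<in> UNIV \<times> N" using N by (auto simp: open_Times mem_Times_iff)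
      show "finite (\<Union>z'\<in>({0..1} \<times> geometric_cell \<sigma>) \<inter> (UNIV \<times> N). supp (?h z'))"
        by (rule finite_subset[OF _ N(3)]) (use supp_h in fastforce)
    qed
  qed (use L in \<open>auto simp: simplicial_complex_def\<close>)
qed auto

section \<open>Projection to a set of positive reach\<close>

definition nearest_point :: "'a::metric_space set \<Rightarrow> 'a \<Rightarrow> 'a" where
  "nearest_point X p = (THE x. x \<in> X \<and> (\<forall>x'\<in>X. dist x p \<le> dist x' p))"

lemma Unp_iff: "p \<in> Unp X \<longleftrightarrow> (\<exists>!x. x \<in> X \<and> (\<forall>x'\<in>X. dist x p \<le> dist x' p))"
  by (simp add: Unp_def)

lemma nearest_point:
  assumes "p \<in> Unp X"
  shows nearest_point_in: "nearest_point X p \<in> X"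
    and nearest_point_le: "x \<in> X \<Longrightarrow> dist (nearest_point X p) p \<le> dist x p"
  using theI'[OF assms[unfolded Unp_iff]] by (auto simp: nearest_point_def)

lemma nearest_point_unique:
  assumes "p \<in> Unp X" "x \<in> X" "\<And>x'. x' \<in> X \<Longrightarrow> dist x p \<le> dist x' p"
  shows "nearest_point X p = x"
  unfolding nearest_point_def using assms by (intro the1_equality) (auto simp: Unp_iff)

lemma nearest_point_self: "x \<in> Unp X \<Longrightarrow> x \<in> X \<Longrightarrow> nearest_point X x = x"
  by (rule nearest_point_unique) auto

text \<open>A real \<open>R\<close> at most the reach is fixed, so that no extended values occur and
  infinite reach is treated on the same footing.\<close>

locale reach_at_least =
  fixes X :: "'a::euclidean_space set" and R :: real
  assumes R: "R > 0" and ball_Unp: "x \<in> X \<Longrightarrow> ball x R \<subseteq> Unp X"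
begin

lemma mem_Unp: "x \<in> X \<Longrightarrow> dist x p < R \<Longrightarrow> p \<in> Unp X"
  using ball_Unp[of x] by auto

lemma nearest_self: "x \<in> X \<Longrightarrow> nearest_point X x = x"
  using mem_Unp[of x x] R by (simp add: nearest_point_self)

text \<open>A limit point of \<open>X\<close> is close enough to \<open>X\<close> to have a nearest
  point there, and that point is at distance 0.\<close>

lemma closed_X: "closed X"
  unfolding closed_sequential_limits
proof (intro allI impI, elim conjE)
  fix s p assume s: "\<forall>n. s n \<in> X" "s \<longlonglongrightarrow> p"
  then obtain n where "dist (s n) p < R"
    using R by (metis LIMSEQ_iff_nz lim_sequentially order_refl)
  then have p: "p \<in> Unp X" using s mem_Unp by blast
  have "(\<lambda>n. dist (s n) p) \<longlonglongrightarrow> 0" using s(2) tendsto_dist_iff by blast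
  then have "dist (nearest_point X p) p \<le> 0"
    by (rule LIMSEQ_le_const) (use nearest_point_le[OF p] s in auto)
  then show "p \<in> X" using nearest_point_in[OF p] by simp
qed

text \<open>Closed graph theorem: locally the values stay in a compact set, and by uniqueness the
  graph is cut out by the closed conditions that no point of \<open>X\<close> is nearer than the
  value.\<close>

lemma continuous_on_nearest_point: "continuous_on (\<Union>x\<in>X. ball x R) (nearest_point X)"
proof -
  have "continuous (at p) (nearest_point X)" if p: "x \<in> X" "p \<in> ball x R" for x p
  proof -
    let ?S = "ball p 1 \<inter> ball x R"
    \<comment> \<open>Moving from \<open>p\<close> to \<open>q\<close> lets the distance from
      \<open>p\<close> to the nearest point grow by at most twice the distance of \<open>p\<close>
      and \<open>q\<close>, which is below 1; hence the 2.\<close>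
    define r where "r = dist (nearest_point X p) p + 2"
    let ?T = "X \<inter> cball p r"
    have U: "q \<in> Unp X" if "q \<in> ball x R" for q using that mem_Unp[OF p(1)] by auto
    have T: "nearest_point X q \<in> ?T" if q: "q \<in> ?S" for q
    proof -
      have "dist (nearest_point X q) p \<le> dist (nearest_point X q) q + dist q p" by (rule dist_triangle)
      also have "dist (nearest_point X q) q \<le> dist (nearest_point X p) q"
        using q p by (intro nearest_point_le nearest_point_in U) auto
      also have "\<dots> \<le> dist (nearest_point X p) p + dist p q" by (rule dist_triangle)
      finally show ?thesis
        using nearest_point_in[OF U, of q] q by (auto simp: r_def dist_commute)
    qed
    have "continuous_on ?S (nearest_point X)"
    proof (rule continuous_closed_graph_eq[THEN iffD2])
      show "compact ?T" using closed_X by (simp add: closed_Int_compact)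
      show "nearest_point X \<in> ?S \<rightarrow> ?T" using T by blast
      have "(\<lambda>q. (q, nearest_point X q)) ` ?S = (?S \<times> ?T) \<inter> (\<Inter>x'\<in>X. {z. dist (snd z) (fst z) \<le> dist x' (fst z)})"
        using T nearest_point_le[OF U] nearest_point_unique[OF U] by (force simp: image_iff)
      moreover have "closed (\<Inter>x'\<in>X. {z. dist (snd z) (fst z) \<le> dist x' (fst z)})"
        by (intro closed_INT ballI closed_Collect_le continuous_intros)
      ultimately show "closedin (top_of_set (?S \<times> ?T)) ((\<lambda>q. (q, nearest_point X q)) ` ?S)"
        by (simp add: closedin_closed_Int)
    qed
    moreover have "p \<in> ?S" "open ?S" using p by (auto intro: open_Int)
    ultimately show ?thesis using continuous_on_eq_continuous_at by blast
  qed
  then show ?thesis by (auto intro!: continuous_at_imp_continuous_on)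
qed

text \<open>The map \<open>F\<close> pushes \<open>q\<close> away from the nearest point of \<open>p\<close>.  At a Brouwer fixed point \<open>p\<close> of \<open>F\<close>,
  the point \<open>q\<close> lies between \<open>p\<close> and the nearest point of \<open>p\<close>, which must therefore be the one of \<open>q\<close>.\<close>

lemma nearest_point_extend:
  assumes q: "x\<^sub>0 \<in> X" "dist x\<^sub>0 q < R" and zn: "norm n = 1" and t: "0 < t" "t < R"
    and z: "z \<in> X" and qz: "q = z + t *\<^sub>R n" and ge: "\<And>x. x \<in> X \<Longrightarrow> t \<le> dist x q"
  shows "\<exists>t'>t. \<forall>x\<in>X. t' \<le> dist x (z + t' *\<^sub>R n)"
proof -
  obtain \<eta> where \<eta>: "\<eta> > 0" "cball q \<eta> \<subseteq> ball x\<^sub>0 R"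
    using q open_contains_cball[of "ball x\<^sub>0 R"] by (metis mem_ball open_ball)
  have tz: "dist z q = t" using qz zn t by (simp add: dist_norm)
  define F where "F p = q + (\<eta> / norm (q - nearest_point X p)) *\<^sub>R (q - nearest_point X p)" for p
  have U: "p \<in> Unp X" if "p \<in> cball q \<eta>" for p
    using that \<eta>(2) ball_Unp[OF q(1)] by auto
  have nz: "q - nearest_point X p \<noteq> 0" if "p \<in> cball q \<eta>" for p
    using ge[OF nearest_point_in[OF U[OF that]]] t by auto
  have "cball q \<eta> \<subseteq> (\<Union>x\<in>X. ball x R)" using \<eta>(2) q(1) by blast
  then have "continuous_on (cball q \<eta>) (nearest_point X)"
    using continuous_on_nearest_point continuous_on_subset by blast
  then have contF: "continuous_on (cball q \<eta>) F"
    unfolding F_def using nz by (intro continuous_intros) auto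
  have "F p \<in> cball q \<eta>" if "p \<in> cball q \<eta>" for p
    using nz[OF that] \<eta>(1) by (simp add: F_def dist_norm)
  then obtain p where p: "p \<in> cball q \<eta>" "F p = p"
    using brouwer_ball[OF \<eta>(1) contF] by blast
  let ?w = "nearest_point X p"
  let ?l = "norm (q - ?w)"
  have l: "?l > 0" using nz[OF p(1)] by simp
  have w: "?w \<in> X" by (rule nearest_point_in[OF U[OF p(1)]])
  have "p - ?w = (1 + \<eta> / ?l) *\<^sub>R (q - ?w)"
    using p(2) unfolding F_def by (simp add: algebra_simps)
  then have "norm (p - ?w) = (1 + \<eta> / ?l) * ?l"
    using l \<eta>(1) by simp
  then have pw: "dist ?w p = ?l + \<eta>"
    using l by (simp add: dist_norm norm_minus_commute field_simps)
  \<comment> \<open>\<open>z\<close> competes with \<open>?w\<close> at \<open>p\<close>, which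
    bounds \<open>?l\<close> by \<open>t\<close>. As no point of \<open>X\<close> is closer to
    \<open>q\<close> than \<open>t\<close>, both are nearest points of \<open>q\<close>, and
    uniqueness identifies them.\<close>
  have "?l + \<eta> \<le> dist z p" using nearest_point_le[OF U[OF p(1)] z] pw by simp
  also have "\<dots> \<le> t + \<eta>" using dist_triangle[of z p q] tz p(1) by simp
  finally have "?l \<le> t" by simp
  moreover have "t \<le> ?l" using ge[OF w] by (simp add: dist_norm norm_minus_commute)
  ultimately have lt: "?l = t" by simp
  have qU: "q \<in> Unp X" using q mem_Unp by blast
  have "nearest_point X q = ?w"
    using lt ge by (intro nearest_point_unique[OF qU w]) (simp add: dist_norm norm_minus_commute)
  moreover have "nearest_point X q = z"
    using tz ge by (intro nearest_point_unique[OF qU z]) simp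
  ultimately have wz: "?w = z" by simp
  have "p = z + (t + \<eta>) *\<^sub>R n"
    using p(2) lt t unfolding F_def wz by (simp add: qz algebra_simps)
  moreover have "t + \<eta> \<le> dist x p" if "x \<in> X" for x
    using nearest_point_le[OF U[OF p(1)] that] pw lt by simp
  ultimately show ?thesis using \<eta>(1) by (intro exI[of _ "t + \<eta>"]) simp
qed

text \<open>Compare Federer, Curvature Measures, Theorem 4.8.\<close>

lemma nearest_point_ray:
  assumes q: "x\<^sub>0 \<in> X" "dist x\<^sub>0 q < R" and ne: "q \<noteq> nearest_point X q" and a: "a < R" and x: "x \<in> X"
  defines "z \<equiv> nearest_point X q"
  defines "n \<equiv> (q - z) /\<^sub>R norm (q - z)"
  shows "a \<le> dist x (z + a *\<^sub>R n)"
proof -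
  define P where "P t \<longleftrightarrow> (\<forall>x\<in>X. t \<le> dist x (z + t *\<^sub>R n))" for t
  have qU: "q \<in> Unp X" using q mem_Unp by blast
  have z: "z \<in> X" unfolding z_def by (rule nearest_point_in[OF qU])
  have n: "norm n = 1" using ne by (simp add: n_def z_def)
  have r0: "norm (q - z) > 0" using ne by (simp add: z_def)
  have down: "P s" if "P t" "s \<le> t" for s t
    unfolding P_def
  proof
    fix x assume "x \<in> X"
    have "dist x (z + t *\<^sub>R n) \<le> dist x (z + s *\<^sub>R n) + dist (z + s *\<^sub>R n) (z + t *\<^sub>R n)"
      by (rule dist_triangle)
    also have "dist (z + s *\<^sub>R n) (z + t *\<^sub>R n) = t - s"
      using that n by (simp add: dist_norm flip: scaleR_diff_left)
    finally show "s \<le> dist x (z + s *\<^sub>R n)"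
      using that \<open>x \<in> X\<close> by (force simp: P_def)
  qed
  have Pr: "P (norm (q - z))"
  proof -
    have "z + norm (q - z) *\<^sub>R n = q" using r0 by (simp add: n_def)
    then show ?thesis
      using nearest_point_le[OF qU] by (simp add: P_def z_def dist_norm norm_minus_commute)
  qed
  have "P a"
  proof (rule ccontr)
    assume "\<not> P a"
    then have bd: "t < a" if "P t" for t using down[OF that, of a] by force
    let ?A = "{t. P t}"
    have ne: "?A \<noteq> {}" "bdd_above ?A" using Pr bd by (auto intro!: bdd_aboveI less_imp_le)
    have "?A = (\<Inter>x\<in>X. {t. t \<le> dist x (z + t *\<^sub>R n)})" by (auto simp: P_def)
    also have "closed \<dots>" by (intro closed_INT ballI closed_Collect_le continuous_intros)
    finally have "closed ?A" .
    \<comment> \<open>The supremum of the admissible radii is attained, and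
      \<open>nearest_point_extend\<close> would enlarge it as long as it is below
      \<open>R\<close>.\<close>
    then have PS: "P (Sup ?A)" using closed_contains_Sup[OF ne] by simp
    have t: "0 < Sup ?A" "Sup ?A < R"
      using less_le_trans[OF r0 cSup_upper[OF _ ne(2), of "norm (q - z)"]] Pr bd[OF PS] a by simp_all
    have "dist z (z + Sup ?A *\<^sub>R n) < R" using t n by (simp add: dist_norm)
    then obtain t' where "t' > Sup ?A" "P t'"
      using nearest_point_extend[OF z _ n t z refl] PS unfolding P_def by blast
    then show False using cSup_upper[OF _ ne(2), of t'] by simp
  qed
  then show ?thesis using x by (simp add: P_def)
qed

text \<open>The open ball of radius \<open>a\<close> that touches \<open>z\<close> on the side of
  \<open>q\<close> contains no point of \<open>X\<close>, by \<open>nearest_point_ray\<close>.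
  Expanding the squared distance of \<open>x\<close> from its centre gives the inequality.\<close>

lemma nearest_point_inner:
  assumes q: "x\<^sub>0 \<in> X" "dist x\<^sub>0 q < R" and a: "0 < a" "a < R" and x: "x \<in> X"
  defines "z \<equiv> nearest_point X q"
  shows "2 * a * ((q - z) \<bullet> (x - z)) \<le> norm (q - z) * (norm (x - z))\<^sup>2"
proof (cases "q = z")
  case False
  then have ne: "q \<noteq> nearest_point X q" and a0: "a > 0" using a by (auto simp: z_def)
  let ?r = "norm (q - z)"
  have r: "?r > 0" using False by simp
  define n where "n = (q - z) /\<^sub>R ?r"
  have qn: "q - z = ?r *\<^sub>R n" using r by (simp add: n_def)
  have nn: "n \<bullet> n = 1" using r by (simp add: n_def dot_square_norm power2_eq_square)
  have "a \<le> norm (x - z - a *\<^sub>R n)"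
    using nearest_point_ray[OF q ne a(2) x] by (simp add: dist_norm n_def z_def algebra_simps)
  then have "a\<^sup>2 \<le> (norm (x - z - a *\<^sub>R n))\<^sup>2" using a0 by (intro power_mono) auto
  also have "\<dots> = (norm (x - z))\<^sup>2 - 2 * a * (n \<bullet> (x - z)) + a\<^sup>2"
  proof -
    have "(norm (y - a *\<^sub>R n))\<^sup>2 = (norm y)\<^sup>2 - 2 * a * (n \<bullet> y) + a\<^sup>2" for y
      unfolding power2_norm_eq_inner using nn
      by (simp add: inner_diff_left inner_diff_right inner_commute power2_eq_square)
    then show ?thesis .
  qed
  finally have "2 * a * (n \<bullet> (x - z)) \<le> (norm (x - z))\<^sup>2" by simp
  then have "?r * (2 * a * (n \<bullet> (x - z))) \<le> ?r * (norm (x - z))\<^sup>2" using r by simp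
  moreover have "2 * a * ((q - z) \<bullet> (x - z)) = ?r * (2 * a * (n \<bullet> (x - z)))"
    by (subst qn) simp
  ultimately show ?thesis by (simp only:)
qed simp

text \<open>\<open>nearest_point_inner\<close> is used twice: averaged over the points
  \<open>x i\<close> it bounds their mean squared distance \<open>V\<close> from \<open>z\<close>
  below, and at \<open>a\<close> it bounds the inner product of \<open>q - z\<close> and
  \<open>z - a\<close> below. Expanding the mean squared distance from \<open>a\<close> about
  \<open>z\<close> brings the two bounds together.\<close>

lemma nearest_point_convex_in_ball:
  assumes a: "a \<in> X" and \<alpha>: "0 < \<alpha>" "\<alpha> < R"
    and I: "finite I" "\<And>i. i \<in> I \<Longrightarrow> 0 \<le> w i" "sum w I = 1"
    and x: "\<And>i. i \<in> I \<Longrightarrow> x i \<in> X" "\<And>i. i \<in> I \<Longrightarrow> dist a (x i) < \<alpha>"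
  shows "dist a (nearest_point X (\<Sum>i\<in>I. w i *\<^sub>R x i)) < \<alpha>"
proof -
  define q where "q = (\<Sum>i\<in>I. w i *\<^sub>R x i)"
  have "q \<in> ball a \<alpha>"
    unfolding q_def by (rule convex_sum) (use I x in auto)
  then have qa: "dist a q < \<alpha>" "dist a q < R" using \<alpha> by auto
  define z where "z = nearest_point X q"
  have qU: "q \<in> Unp X" using mem_Unp[OF a qa(2)] .
  define r where "r = norm (q - z)"
  \<comment> \<open>Strictness makes the factor \<open>\<alpha> - r\<close> positive, so that it can
    be cancelled at the end.\<close>
  have r: "r < \<alpha>" "0 \<le> r"
    using nearest_point_le[OF qU a] qa by (auto simp: r_def z_def dist_norm norm_minus_commute)
  have lin: "(\<Sum>i\<in>I. w i * (v \<bullet> (x i - z))) = v \<bullet> (q - z)" for v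
  proof -
    have "(\<Sum>i\<in>I. w i * (v \<bullet> (x i - z))) = v \<bullet> (\<Sum>i\<in>I. w i *\<^sub>R (x i - z))"
      by (simp add: inner_sum_right)
    also have "(\<Sum>i\<in>I. w i *\<^sub>R (x i - z)) = q - z"
      using I(3) by (simp add: q_def scaleR_diff_right sum_subtractf flip: scaleR_sum_left)
    finally show ?thesis .
  qed
  define V where "V = (\<Sum>i\<in>I. w i * (norm (x i - z))\<^sup>2)"
  have "2 * \<alpha> * r\<^sup>2 \<le> r * V"
  proof -
    have "2 * \<alpha> * r\<^sup>2 = 2 * \<alpha> * (\<Sum>i\<in>I. w i * ((q - z) \<bullet> (x i - z)))"
      by (simp add: lin r_def power2_norm_eq_inner)
    also have "\<dots> = (\<Sum>i\<in>I. w i * (2 * \<alpha> * ((q - z) \<bullet> (x i - z))))"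
      by (simp add: sum_distrib_left mult_ac)
    also have "\<dots> \<le> (\<Sum>i\<in>I. w i * (r * (norm (x i - z))\<^sup>2))"
      unfolding r_def z_def
      by (intro sum_mono mult_left_mono nearest_point_inner[OF a qa(2) \<alpha>] x I)
    finally show ?thesis by (simp add: V_def sum_distrib_left mult_ac)
  qed
  then have V: "2 * \<alpha> * r \<le> V"
  proof (cases "r = 0")
    case True
    then show ?thesis using I by (simp add: V_def sum_nonneg)
  qed (use r in \<open>simp add: power2_eq_square\<close>)
  have inner: "- (r * (norm (z - a))\<^sup>2) \<le> 2 * \<alpha> * ((q - z) \<bullet> (z - a))"
    using nearest_point_inner[OF a qa(2) \<alpha> a]
    by (simp add: z_def[symmetric] r_def[symmetric] norm_minus_commute inner_diff_right algebra_simps)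
  have "V + 2 * ((q - z) \<bullet> (z - a)) + (norm (z - a))\<^sup>2 = (\<Sum>i\<in>I. w i * (norm (x i - a))\<^sup>2)"
  proof -
    have "(norm (x i - a))\<^sup>2 = (norm (x i - z))\<^sup>2 + 2 * ((z - a) \<bullet> (x i - z)) + (norm (z - a))\<^sup>2" for i
      by (simp add: power2_norm_eq_inner inner_diff_left inner_diff_right inner_commute algebra_simps)
    then have "(\<Sum>i\<in>I. w i * (norm (x i - a))\<^sup>2) = V + 2 * (\<Sum>i\<in>I. w i * ((z - a) \<bullet> (x i - z))) + (norm (z - a))\<^sup>2"
      using I(3) by (simp add: V_def sum.distrib distrib_left mult.left_commute[of _ 2] flip: sum_distrib_left sum_distrib_right)
    then show ?thesis by (simp add: lin inner_commute)
  qed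
  also have "\<dots> < \<alpha>\<^sup>2"
  proof -
    have "(\<Sum>i\<in>I. w i * (norm (x i - a))\<^sup>2) < (\<Sum>i\<in>I. w i * \<alpha>\<^sup>2)"
    proof (rule sum_strict_mono_ex1[OF I(1)])
      have lt: "(norm (x i - a))\<^sup>2 < \<alpha>\<^sup>2" if "i \<in> I" for i
        using x(2)[OF that] by (intro power_strict_mono) (auto simp: dist_norm norm_minus_commute)
      then show "\<forall>i\<in>I. w i * (norm (x i - a))\<^sup>2 \<le> w i * \<alpha>\<^sup>2"
        using I(2) lt by (simp add: mult_left_mono less_imp_le)
      obtain i where "i \<in> I" "w i > 0"
        using I(2,3) by (metis order_less_le sum.neutral zero_neq_one)
      then show "\<exists>i\<in>I. w i * (norm (x i - a))\<^sup>2 < w i * \<alpha>\<^sup>2"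
        using lt mult_strict_left_mono by blast
    qed
    then show ?thesis using I(3) by (simp flip: sum_distrib_right)
  qed
  finally have *: "V + 2 * ((q - z) \<bullet> (z - a)) + (norm (z - a))\<^sup>2 < \<alpha>\<^sup>2" .
  define N where "N = (norm (z - a))\<^sup>2"
  have "\<alpha> * (2 * \<alpha> * r + 2 * ((q - z) \<bullet> (z - a)) + N) < \<alpha> * \<alpha>\<^sup>2"
    using * V \<alpha> by (simp add: N_def)
  then have "(\<alpha> - r) * N < \<alpha> * \<alpha>\<^sup>2 - 2 * \<alpha>\<^sup>2 * r"
    using inner by (simp add: N_def algebra_simps power2_eq_square)
  \<comment> \<open>The two sides differ by \<open>\<alpha>\<^sup>2 * r\<close>.\<close>
  also have "\<dots> \<le> (\<alpha> - r) * \<alpha>\<^sup>2"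
    using r by (simp add: algebra_simps)
  finally have "N < \<alpha>\<^sup>2" using r by (simp add: mult_less_cancel_left)
  then have "norm (z - a) < \<alpha>" using \<alpha> by (simp add: N_def power_less_imp_less_base)
  then show ?thesis by (simp add: z_def q_def dist_norm norm_minus_commute)
qed

end

section \<open>Averaging over the faces of a simplex\<close>

text \<open>A partition of unity subordinate to a locally finite refinement is indexed by the sets
  of the refinement. Each of these is assigned a centre in \<open>A\<close> whose ball contains it,
  and the functions with the same centre are added.\<close>

lemma barycentric_partition_of_unity:
  fixes S A :: "'a::euclidean_space set"
  assumes "S \<subseteq> (\<Union>a\<in>A. ball a \<delta>)"
  obtains s :: "'a \<Rightarrow> 'a \<Rightarrow> real"
  where "\<And>x. x \<in> S \<Longrightarrow> barycentric (s x) \<and> supp (s x) \<subseteq> A \<inter> ball x \<delta>"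
    and "\<And>a. continuous_on S (\<lambda>x. s x a)"
    and "\<And>x. x \<in> S \<Longrightarrow> \<exists>N. open N \<and> x \<in> N \<and> finite (\<Union>x'\<in>S \<inter> N. supp (s x'))"
proof -
  obtain \<C> where cover: "S \<subseteq> \<Union>\<C>"
    and ref: "\<And>U. U \<in> \<C> \<Longrightarrow> open U \<and> (\<exists>T. T \<in> (\<lambda>a. ball a \<delta>) ` A \<and> U \<subseteq> T)"
    and fin: "\<And>x. x \<in> S \<Longrightarrow> \<exists>V. open V \<and> x \<in> V \<and> finite {U. U \<in> \<C> \<and> (U \<inter> V \<noteq> {})}"
  proof (rule paracompact[OF assms])
    show "open T" if "T \<in> (\<lambda>a. ball a \<delta>) ` A" for T using that by auto
  qed (rule that, assumption+)
  have op: "\<And>U. U \<in> \<C> \<Longrightarrow> open U" using ref by blast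
  obtain F :: "'a set \<Rightarrow> 'a \<Rightarrow> real" where
    F: "\<And>U. U \<in> \<C> \<Longrightarrow> continuous_on S (F U) \<and> (\<forall>x \<in> S. 0 \<le> F U x)"
    and F0: "\<And>x U. \<lbrakk>U \<in> \<C>; x \<in> S; x \<notin> U\<rbrakk> \<Longrightarrow> F U x = 0"
    and F1: "\<And>x. x \<in> S \<Longrightarrow> supp_sum (\<lambda>W. F W x) \<C> = 1"
    and Ffin: "\<And>x. x \<in> S \<Longrightarrow> \<exists>V. open V \<and> x \<in> V \<and> finite {U \<in> \<C>. \<exists>x\<in>V. F U x \<noteq> 0}"
  proof (rule subordinate_partition_of_unity[OF cover op])
    show "\<exists>V. open V \<and> x \<in> V \<and> finite {U \<in> \<C>. U \<inter> V \<noteq> {}}" if "x \<in> S" for x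
      using fin[OF that] .
  qed (assumption | rule that)+
  have "\<forall>U\<in>\<C>. \<exists>a. a \<in> A \<and> U \<subseteq> ball a \<delta>" using ref by blast
  then obtain rep where rep: "\<And>U. U \<in> \<C> \<Longrightarrow> rep U \<in> A \<and> U \<subseteq> ball (rep U) \<delta>" by metis
  define s where "s x a = (\<Sum>U\<in>{U\<in>\<C>. F U x \<noteq> 0 \<and> rep U = a}. F U x)" for x a
  \<comment> \<open>Any finite \<open>G\<close> containing the nonzero terms may serve as index set;
    one such \<open>G\<close> works on a whole neighbourhood, which gives continuity.\<close>
  have s_eq: "s x a = (\<Sum>U\<in>{U\<in>G. rep U = a}. F U x)"
    if "finite G" "G \<subseteq> \<C>" "{U\<in>\<C>. F U x \<noteq> 0} \<subseteq> G" for x a G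
    unfolding s_def by (rule sum.mono_neutral_left) (use that in auto)
  have supp_sub: "supp (s x) \<subseteq> rep ` {U\<in>\<C>. F U x \<noteq> 0}" for x
  proof
    fix a assume "a \<in> supp (s x)"
    then have "{U\<in>\<C>. F U x \<noteq> 0 \<and> rep U = a} \<noteq> {}" unfolding supp_def s_def by force
    then show "a \<in> rep ` {U\<in>\<C>. F U x \<noteq> 0}" by blast
  qed
  have finF: "finite {U\<in>\<C>. F U x \<noteq> 0}" if "x \<in> S" for x
  proof -
    from Ffin[OF that] obtain V where "x \<in> V" "finite {U \<in> \<C>. \<exists>x\<in>V. F U x \<noteq> 0}" by blast
    then show ?thesis by (elim finite_subset[rotated]) auto
  qed
  show thesis
  proof (rule that[of s])
    fix x assume x: "x \<in> S"
    let ?G = "{U\<in>\<C>. F U x \<noteq> 0}"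
    note fG = finF[OF x]
    have "finite (supp (s x))" using supp_sub[of x] fG finite_subset by blast
    moreover have "0 \<le> s x a" for a unfolding s_def using F x by (intro sum_nonneg) auto
    moreover have "sum (s x) (supp (s x)) = 1"
    proof -
      have "sum (s x) (supp (s x)) = sum (s x) (rep ` ?G)"
        by (rule sum.mono_neutral_left) (use fG supp_sub[of x] in \<open>auto simp: supp_def\<close>)
      also have "\<dots> = (\<Sum>a\<in>rep ` ?G. \<Sum>U\<in>{U\<in>?G. rep U = a}. F U x)"
        by (intro sum.cong refl s_eq fG) auto
      also have "\<dots> = (\<Sum>U\<in>?G. F U x)" by (rule sum.image_gen[OF fG, symmetric])
      also have "\<dots> = 1" using F1[OF x] by (simp add: supp_sum_def support_on_def)
      finally show ?thesis .
    qed
    moreover have "supp (s x) \<subseteq> A \<inter> ball x \<delta>"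
    proof
      fix a assume "a \<in> supp (s x)"
      then obtain U where U: "U \<in> \<C>" "F U x \<noteq> 0" "a = rep U" using supp_sub by blast
      then have "x \<in> U" using F0 x by blast
      then show "a \<in> A \<inter> ball x \<delta>" using rep[OF U(1)] U(3) by (auto simp: dist_commute)
    qed
    ultimately show "barycentric (s x) \<and> supp (s x) \<subseteq> A \<inter> ball x \<delta>"
      by (simp add: barycentric_def)
    obtain V where V: "open V" "x \<in> V" "finite {U \<in> \<C>. \<exists>x\<in>V. F U x \<noteq> 0}" using Ffin[OF x] by blast
    have "finite (\<Union>x'\<in>S \<inter> V. supp (s x'))"
      by (rule finite_subset[OF _ finite_imageI[OF V(3), of rep]]) (use supp_sub in fastforce)
    with V show "\<exists>N. open N \<and> x \<in> N \<and> finite (\<Union>x'\<in>S \<inter> N. supp (s x'))" by blast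
  next
    fix a
    show "continuous_on S (\<lambda>x. s x a)"
      unfolding continuous_on_eq_continuous_within
    proof
      fix x assume x: "x \<in> S"
      obtain V where V: "open V" "x \<in> V" "finite {U \<in> \<C>. \<exists>x\<in>V. F U x \<noteq> 0}" using Ffin[OF x] by blast
      let ?G = "{U \<in> \<C>. \<exists>x\<in>V. F U x \<noteq> 0}"
      have "continuous_on (S \<inter> V) (\<lambda>x. \<Sum>U\<in>{U\<in>?G. rep U = a}. F U x)"
        by (intro continuous_on_sum) (use F continuous_on_subset in blast)
      moreover have "(\<Sum>U\<in>{U\<in>?G. rep U = a}. F U y) = s y a" if "y \<in> S \<inter> V" for y
        by (rule s_eq[OF V(3), symmetric]) (use that in auto)
      ultimately have "continuous_on (S \<inter> V) (\<lambda>x. s x a)"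
        by (rule continuous_on_eq)
      then have "continuous (at x within (S \<inter> V)) (\<lambda>x. s x a)"
        using x V(2) by (simp add: continuous_on_eq_continuous_within)
      moreover have "at x within (S \<inter> V) = at x within S"
        by (rule at_within_nhd[OF V(2,1)]) blast
      ultimately show "continuous (at x within S) (\<lambda>x. s x a)" by simp
    qed
  qed
qed

text \<open>The square sum is a continuous lower bound for the largest barycentric coordinate that is
  polynomial in the coordinates; it serves as the threshold for a coordinate to be large.\<close>

definition square_sum :: "'v set \<Rightarrow> ('v \<Rightarrow> real) \<Rightarrow> real" where
  "square_sum \<sigma> t = (\<Sum>v\<in>\<sigma>. (t v)\<^sup>2)"

text \<open>The excess of the coordinates over half the square sum, rescaled to total 1. On a cell
  some coordinate is at least the square sum, so taking half of it leaves a strict margin and the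
  denominator is positive.\<close>

definition core_part :: "'v set \<Rightarrow> ('v \<Rightarrow> real) \<Rightarrow> 'v \<Rightarrow> real" where
  "core_part \<sigma> t v = max 0 (t v - square_sum \<sigma> t / 2) / (\<Sum>u\<in>\<sigma>. max 0 (t u - square_sum \<sigma> t / 2))"

definition core :: "('v \<Rightarrow> real) \<Rightarrow> 'v set" where
  "core t = {v. square_sum (supp t) t / 2 < t v}"

text \<open>The weight is nonzero only on faces between \<open>core t\<close> and \<open>supp t\<close>, and vertices outside \<open>supp t\<close>
  contribute the factor 1 to the second product; this makes \<open>center\<close> independent of \<open>\<sigma>\<close>.\<close>

definition face_weight :: "'v set \<Rightarrow> ('v \<Rightarrow> real) \<Rightarrow> 'v set \<Rightarrow> real" where
  "face_weight \<sigma> t S = (\<Prod>v\<in>S. t v) * (\<Prod>v\<in>\<sigma> - S. max 0 (1 - 2 * t v / square_sum \<sigma> t))"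

definition center :: "('v set \<Rightarrow> 'a::real_vector) \<Rightarrow> 'v set \<Rightarrow> ('v \<Rightarrow> real) \<Rightarrow> 'a" where
  "center c \<sigma> t = (\<Sum>S\<in>Pow \<sigma>. (face_weight \<sigma> t S / (\<Sum>T\<in>Pow \<sigma>. face_weight \<sigma> t T)) *\<^sub>R c S)"

section \<open>Large vertices and face weights at a point of a fixed cell\<close>

context
  fixes \<sigma> :: "'v set" and t :: "'v \<Rightarrow> real"
  assumes fin: "finite \<sigma>" and t: "t \<in> geometric_cell \<sigma>"
begin

lemma cell_facts: "0 \<le> t v" "v \<notin> \<sigma> \<Longrightarrow> t v = 0" "sum t \<sigma> = 1"
  using t by (auto simp: geometric_cell_def)

lemma square_sum_supp: "square_sum (supp t) t = square_sum \<sigma> t"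
  unfolding square_sum_def
  by (rule sum.mono_neutral_left) (use fin cell_facts in \<open>auto simp: supp_def\<close>)

lemma square_sum_pos: "0 < square_sum \<sigma> t"
proof -
  obtain v where "v \<in> \<sigma>" "t v \<noteq> 0"
    using cell_facts(3) sum.not_neutral_contains_not_neutral[of t \<sigma>] by auto
  then show ?thesis unfolding square_sum_def using fin by (intro sum_pos2[of _ v]) auto
qed

text \<open>The square sum is the mean of the coordinates weighted by themselves, and a mean cannot
  exceed all of its values.\<close>

lemma square_sum_le_coordinate: "\<exists>v\<in>\<sigma>. square_sum \<sigma> t \<le> t v"
proof (rule ccontr)
  assume "\<not> ?thesis"
  then have lt: "t v < square_sum \<sigma> t" if "v \<in> \<sigma>" for v using that by force
  obtain v where v: "v \<in> \<sigma>" "t v \<noteq> 0"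
    using cell_facts(3) sum.not_neutral_contains_not_neutral[of t \<sigma>] by auto
  have "(\<Sum>v\<in>\<sigma>. (t v)\<^sup>2) < (\<Sum>v\<in>\<sigma>. t v * square_sum \<sigma> t)"
  proof (rule sum_strict_mono_ex1[OF fin])
    show "\<forall>v\<in>\<sigma>. (t v)\<^sup>2 \<le> t v * square_sum \<sigma> t"
      using lt cell_facts(1) by (simp add: power2_eq_square mult_left_mono less_imp_le)
    show "\<exists>v\<in>\<sigma>. (t v)\<^sup>2 < t v * square_sum \<sigma> t"
      using v lt[OF v(1)] cell_facts(1)[of v] by (intro bexI[of _ v]) (auto simp: power2_eq_square)
  qed
  then show False using cell_facts(3) by (simp add: square_sum_def flip: sum_distrib_right)
qed

lemma core_iff: "v \<in> core t \<longleftrightarrow> square_sum \<sigma> t / 2 < t v"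
  by (simp add: core_def square_sum_supp)

lemma core_subset_supp: "core t \<subseteq> supp t"
  using square_sum_pos by (auto simp: core_iff supp_def)

lemma core_nonempty: "core t \<noteq> {}"
proof -
  obtain v where "square_sum \<sigma> t \<le> t v" using square_sum_le_coordinate by blast
  then have "v \<in> core t" using square_sum_pos by (simp add: core_iff)
  then show ?thesis by blast
qed

lemma core_sum_pos: "0 < (\<Sum>u\<in>\<sigma>. max 0 (t u - square_sum \<sigma> t / 2))"
proof -
  obtain v where "v \<in> \<sigma>" "square_sum \<sigma> t \<le> t v" using square_sum_le_coordinate by blast
  then show ?thesis using fin square_sum_pos by (intro sum_pos2[of _ v]) auto
qed

lemma core_part_cell: "core_part \<sigma> t \<in> geometric_cell \<sigma>"
  using core_sum_pos square_sum_pos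
  by (auto simp: geometric_cell_def core_part_def cell_facts(2) simp flip: sum_divide_distrib)

lemma supp_core_part: "supp (core_part \<sigma> t) = core t"
  using core_sum_pos by (auto simp: supp_def core_part_def core_iff max_def)

lemma core_part_supp: "core_part (supp t) t = core_part \<sigma> t"
proof -
  have "(\<Sum>u\<in>supp t. max 0 (t u - square_sum \<sigma> t / 2)) = (\<Sum>u\<in>\<sigma>. max 0 (t u - square_sum \<sigma> t / 2))"
    by (rule sum.mono_neutral_left) (use fin cell_facts square_sum_pos in \<open>auto simp: supp_def\<close>)
  then show ?thesis by (simp add: core_part_def fun_eq_iff square_sum_supp)
qed

lemma face_weight_nonneg: "0 \<le> face_weight \<sigma> t S"
  unfolding face_weight_def using cell_facts(1) by (intro mult_nonneg_nonneg prod_nonneg) auto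

lemma face_weight_nonzero:
  assumes "S \<subseteq> \<sigma>" "face_weight \<sigma> t S \<noteq> 0"
  shows "S \<subseteq> supp t" "core t \<subseteq> S"
proof -
  have fS: "finite S" using assms(1) fin finite_subset by blast
  then show "S \<subseteq> supp t" using assms(2) by (auto simp: face_weight_def supp_def)
  show "core t \<subseteq> S"
  proof
    fix v assume v: "v \<in> core t"
    then have "v \<in> \<sigma>" using core_subset_supp supp_subset_of_cell[OF t] by blast
    moreover have "max 0 (1 - 2 * t v / square_sum \<sigma> t) = 0"
      using v square_sum_pos by (auto simp: core_iff max_def field_simps)
    ultimately show "v \<in> S" using assms(2) fin by (auto simp: face_weight_def)
  qed
qed

lemma face_weight_sum_pos: "0 < (\<Sum>S\<in>Pow \<sigma>. face_weight \<sigma> t S)"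
proof -
  \<comment> \<open>The threshold is not strict: a vertex whose coordinate is exactly half the
    square sum lies outside the core, but omitting it would contribute a factor 0.\<close>
  define S where "S = {v\<in>\<sigma>. square_sum \<sigma> t / 2 \<le> t v}"
  have "0 < face_weight \<sigma> t S"
    unfolding face_weight_def
    using square_sum_pos by (intro mult_pos_pos prod_pos) (auto simp: S_def field_simps)
  moreover have "S \<in> Pow \<sigma>" by (auto simp: S_def)
  ultimately show ?thesis using fin face_weight_nonneg by (intro sum_pos2[of _ S]) auto
qed

lemma face_weight_supp: "S \<subseteq> supp t \<Longrightarrow> face_weight (supp t) t S = face_weight \<sigma> t S"
proof -
  assume "S \<subseteq> supp t"
  have "(\<Prod>v\<in>supp t - S. max 0 (1 - 2 * t v / square_sum \<sigma> t)) = (\<Prod>v\<in>\<sigma> - S. max 0 (1 - 2 * t v / square_sum \<sigma> t))"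
    by (rule prod.mono_neutral_left) (use fin cell_facts in \<open>auto simp: supp_def\<close>)
  then show ?thesis by (simp add: face_weight_def square_sum_supp)
qed

text \<open>Only faces of \<open>supp t\<close> carry weight, and their weights are the same in both
  formulas. Thus \<open>base\<close> below is one function on the realization that agrees on each
  cell with a formula continuous there.\<close>

lemma center_supp: "center c (supp t) t = center c \<sigma> t"
proof -
  have sub: "Pow (supp t) \<subseteq> Pow \<sigma>" using supp_subset_of_cell[OF t] by blast
  have zero: "face_weight \<sigma> t S = 0" if "S \<in> Pow \<sigma> - Pow (supp t)" for S
    using face_weight_nonzero(1)[of S] that by blast
  have W: "(\<Sum>T\<in>Pow (supp t). face_weight (supp t) t T) = (\<Sum>T\<in>Pow \<sigma>. face_weight \<sigma> t T)"
    by (rule sum.mono_neutral_cong_left) (use fin sub zero face_weight_supp in auto)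
  show ?thesis
    unfolding center_def W
    by (rule sum.mono_neutral_cong_left) (use fin sub zero face_weight_supp in auto)
qed

lemma center_convex_combination:
  obtains I w where "finite I" "\<And>S. S \<in> I \<Longrightarrow> 0 \<le> w S" "sum w I = (1::real)"
    "\<And>S. S \<in> I \<Longrightarrow> S \<subseteq> supp t \<and> core t \<subseteq> S" "center c \<sigma> t = (\<Sum>S\<in>I. w S *\<^sub>R c S)"
proof -
  define I where "I = {S\<in>Pow \<sigma>. face_weight \<sigma> t S \<noteq> 0}"
  define W where "W = (\<Sum>T\<in>Pow \<sigma>. face_weight \<sigma> t T)"
  have W: "W > 0" unfolding W_def by (rule face_weight_sum_pos)
  have "sum (face_weight \<sigma> t) I = W"
    unfolding W_def I_def by (rule sum.mono_neutral_left) (use fin in auto)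
  then have "(\<Sum>S\<in>I. face_weight \<sigma> t S / W) = 1" using W by (simp flip: sum_divide_distrib)
  moreover have "center c \<sigma> t = (\<Sum>S\<in>I. (face_weight \<sigma> t S / W) *\<^sub>R c S)"
    unfolding center_def W_def[symmetric] I_def
    by (rule sum.mono_neutral_right) (use fin in auto)
  moreover have "finite I" using fin by (simp add: I_def)
  ultimately show ?thesis
    using that[of I "\<lambda>S. face_weight \<sigma> t S / W"] W face_weight_nonneg face_weight_nonzero
    by (auto simp: I_def)
qed

end

section \<open>Continuity on a cell\<close>

lemma continuous_on_coordinate: "continuous_on S (\<lambda>t::'v \<Rightarrow> real. t v)"
  by (rule continuous_on_subset[OF continuous_on_product_coordinates]) simp

lemma continuous_on_square_sum: "continuous_on S (square_sum \<sigma>)"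
  unfolding square_sum_def by (intro continuous_intros continuous_on_coordinate)

lemma continuous_on_core_part:
  assumes "finite \<sigma>"
  shows "continuous_on (geometric_cell \<sigma>) (\<lambda>t. core_part \<sigma> t v)"
  unfolding core_part_def using core_sum_pos[OF assms]
  by (intro continuous_intros continuous_on_coordinate continuous_on_square_sum ballI) (auto, metis less_irrefl)

lemma continuous_on_center:
  fixes c :: "'v set \<Rightarrow> 'a::real_normed_vector"
  assumes "finite \<sigma>"
  shows "continuous_on (geometric_cell \<sigma>) (center c \<sigma>)"
proof -
  have "continuous_on (geometric_cell \<sigma>) (\<lambda>t. face_weight \<sigma> t S)" for S
    unfolding face_weight_def using square_sum_pos[OF assms]
    by (intro continuous_intros continuous_on_coordinate continuous_on_square_sum ballI) (auto, metis less_irrefl)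
  then show ?thesis
    unfolding center_def using face_weight_sum_pos[OF assms]
    by (intro continuous_intros ballI) (auto, metis less_irrefl)
qed

section \<open>Comparing the set with its Cech complexes\<close>

text \<open>\<open>\<delta>\<close> stands for a radius above the directed Hausdorff distance, so
  \<open>dense\<close> needs no attained infimum. \<open>2 * \<delta> \<le> \<alpha>\<close> turns
  finite subsets of \<open>A\<close> in a \<delta>-ball about a point of \<open>X\<close> into
  simplices of \<open>K\<close>, and \<open>\<delta> \<le> \<epsilon>\<close> does the same for
  \<alpha>-balls and \<open>L\<close>. The bounds by \<open>R\<close> keep the averages of
  witnesses, and the segments from \<open>x\<close> to the average at \<open>s x\<close>, where
  nearest points are unique.\<close>

locale cech_reach = reach_at_least X R for X :: "'a::euclidean_space set" and R :: real +
  fixes A :: "'a set" and \<alpha> \<epsilon> \<delta> :: real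
  assumes AX: "A \<subseteq> X" and pos: "0 < \<delta>" "2 * \<delta> \<le> \<alpha>" "\<delta> \<le> \<epsilon>"
    and le: "\<alpha> + \<delta> \<le> R" "\<alpha> + \<epsilon> \<le> R"
    and dense: "x \<in> X \<Longrightarrow> \<exists>a\<in>A. dist x a < \<delta>"
begin

abbreviation "K \<equiv> cech_complex A A \<alpha>"
abbreviation "L \<equiv> cech_complex A A (\<alpha> + \<epsilon>)"

lemma alpha: "0 < \<alpha>" "\<alpha> < R" "0 < \<epsilon>"
  using pos le by auto

lemma simplicial_complex_cech: "simplicial_complex (cech_complex B C r)"
  unfolding simplicial_complex_def cech_complex_def by (blast intro: finite_subset)

lemma face_in_cech: "\<sigma> \<in> cech_complex B C r \<Longrightarrow> \<rho> \<subseteq> \<sigma> \<Longrightarrow> \<rho> \<in> cech_complex B C r"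
  using simplicial_complex_cech unfolding simplicial_complex_def by blast

lemma finite_simplex: "\<sigma> \<in> cech_complex B C r \<Longrightarrow> finite \<sigma>"
  by (simp add: cech_complex_def)

lemma K_subset_L: "K \<subseteq> L"
  using alpha(3) by (force simp: cech_complex_def)

text \<open>A point of \<open>A\<close> within \<delta> of \<open>x\<close> serves as witness; the
  increase \<epsilon> of the radius pays for moving from \<open>X\<close> to
  \<open>A\<close>.\<close>

lemma ball_in_L:
  assumes "x \<in> X" "finite \<sigma>" "\<sigma> \<subseteq> A \<inter> ball x \<alpha>"
  shows "\<sigma> \<in> L"
proof -
  obtain a where a: "a \<in> A" "dist x a < \<delta>" using dense[OF assms(1)] by blast
  have "dist v a < \<alpha> + \<epsilon>" if "v \<in> \<sigma>" for v
  proof -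
    have "dist x v < \<alpha>" using that assms(3) by auto
    then show ?thesis using a(2) pos(3) dist_triangle2[of v a x] by (simp add: dist_commute)
  qed
  then show ?thesis using assms a(1) by (auto simp: cech_complex_def)
qed

text \<open>Using the small radius whenever possible makes one map on \<open>|L|\<close> restrict to a good map on \<open>|K|\<close>.\<close>

definition witness :: "'a set \<Rightarrow> 'a" where
  "witness \<sigma> = (SOME y. y \<in> A \<and> (\<forall>v\<in>\<sigma>. dist v y < (if \<sigma> \<in> K then \<alpha> else \<alpha> + \<epsilon>)))"

lemma witness:
  assumes "\<sigma> \<in> L"
  shows "witness \<sigma> \<in> A" "v \<in> \<sigma> \<Longrightarrow> dist v (witness \<sigma>) < \<alpha> + \<epsilon>"
    "\<sigma> \<in> K \<Longrightarrow> v \<in> \<sigma> \<Longrightarrow> dist v (witness \<sigma>) < \<alpha>"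
proof -
  have "\<exists>y. y \<in> A \<and> (\<forall>v\<in>\<sigma>. dist v y < (if \<sigma> \<in> K then \<alpha> else \<alpha> + \<epsilon>))"
  proof (cases "\<sigma> \<in> K")
    case True
    then show ?thesis by (auto simp: cech_complex_def)
  next
    case False
    then show ?thesis using assms by (auto simp: cech_complex_def)
  qed
  from someI_ex[OF this] have *: "witness \<sigma> \<in> A" "\<forall>v\<in>\<sigma>. dist v (witness \<sigma>) < (if \<sigma> \<in> K then \<alpha> else \<alpha> + \<epsilon>)"
    unfolding witness_def by auto
  show "witness \<sigma> \<in> A" by (rule *)
  show "dist v (witness \<sigma>) < \<alpha> + \<epsilon>" if "v \<in> \<sigma>"
    using *(2) that alpha(3) by (force split: if_splits)
  show "dist v (witness \<sigma>) < \<alpha>" if "\<sigma> \<in> K" "v \<in> \<sigma>" using *(2) that by auto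
qed

section \<open>The map to \<open>X\<close> and the reduction to large vertices\<close>

definition base :: "('a \<Rightarrow> real) \<Rightarrow> 'a" where
  "base t = center witness (supp t) t"

definition proj :: "('a \<Rightarrow> real) \<Rightarrow> 'a" where
  "proj t = nearest_point X (base t)"

definition shrink :: "('a \<Rightarrow> real) \<Rightarrow> 'a \<Rightarrow> real" where
  "shrink t = core_part (supp t) t"

lemma base_convex_combination:
  assumes "\<sigma> \<in> L" "t \<in> geometric_cell \<sigma>"
  obtains I w where "finite I" "\<And>S. S \<in> I \<Longrightarrow> 0 \<le> w S" "sum w I = (1::real)"
    "\<And>S. S \<in> I \<Longrightarrow> S \<in> L \<and> S \<subseteq> supp t \<and> core t \<subseteq> S" "base t = (\<Sum>S\<in>I. w S *\<^sub>R witness S)"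
proof -
  note fin = finite_simplex[OF assms(1)]
  obtain I w where I: "finite I" "\<And>S. S \<in> I \<Longrightarrow> 0 \<le> w S" "sum w I = (1::real)"
    "\<And>S. S \<in> I \<Longrightarrow> S \<subseteq> supp t \<and> core t \<subseteq> S" "center witness \<sigma> t = (\<Sum>S\<in>I. w S *\<^sub>R witness S)"
    using center_convex_combination[OF fin assms(2)] by blast
  moreover have "S \<in> L" if "S \<in> I" for S
    using I(4)[OF that] supp_subset_of_cell[OF assms(2)] face_in_cech[OF assms(1)] by blast
  moreover have "base t = center witness \<sigma> t"
    by (simp add: base_def center_supp[OF fin assms(2)])
  ultimately show ?thesis by (intro that[of I w]) auto
qed

text \<open>All averaged faces share a core vertex, and their witnesses are within
  \<open>\<alpha> + \<epsilon> \<le> R\<close> of it; balls are convex.\<close>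

lemma base_in_tube:
  assumes "\<sigma> \<in> L" "t \<in> geometric_cell \<sigma>"
  shows "\<exists>x\<in>X. base t \<in> ball x R"
proof -
  note fin = finite_simplex[OF assms(1)]
  obtain a where a: "a \<in> core t" using core_nonempty[OF fin assms(2)] by blast
  then have "a \<in> X"
    using core_subset_supp[OF fin assms(2)] supp_subset_of_cell[OF assms(2)] assms(1) AX
    by (auto simp: cech_complex_def)
  obtain I w where I: "finite I" "\<And>S. S \<in> I \<Longrightarrow> 0 \<le> w S" "sum w I = (1::real)"
    "\<And>S. S \<in> I \<Longrightarrow> S \<in> L \<and> S \<subseteq> supp t \<and> core t \<subseteq> S" "base t = (\<Sum>S\<in>I. w S *\<^sub>R witness S)"
    using base_convex_combination[OF assms] by blast
  have "witness S \<in> ball a R" if "S \<in> I" for S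
    using I(4)[OF that] a witness(2)[of S a] le(2) by auto
  then have "base t \<in> ball a R"
    unfolding I(5) using I by (intro convex_sum) auto
  with \<open>a \<in> X\<close> show ?thesis by blast
qed

lemma continuous_on_base: "\<sigma> \<in> L \<Longrightarrow> continuous_on (geometric_cell \<sigma>) base"
  using continuous_on_center[OF finite_simplex, of \<sigma>]
  by (rule continuous_on_eq) (auto simp: base_def center_supp[OF finite_simplex])

lemma proj_in_X: "\<sigma> \<in> L \<Longrightarrow> t \<in> geometric_cell \<sigma> \<Longrightarrow> proj t \<in> X"
  using base_in_tube ball_Unp nearest_point_in unfolding proj_def by blast

lemma continuous_on_proj:
  assumes "\<sigma> \<in> L"
  shows "continuous_on (geometric_cell \<sigma>) proj"
  unfolding proj_def
  by (rule continuous_on_compose2[OF continuous_on_nearest_point continuous_on_base[OF assms]])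
    (use base_in_tube[OF assms] in blast)

lemma continuous_map_base: "continuous_map (geometric_realization L) euclidean base"
  using continuous_on_base by (intro continuous_map_from_realization) simp

lemma continuous_map_proj: "continuous_map (geometric_realization L) (top_of_set X) proj"
  using continuous_on_proj proj_in_X
  by (intro continuous_map_from_realization) (auto simp: continuous_map_in_subtopology)

text \<open>Every averaged face is a face of \<open>\<sigma>\<close>, hence lies in
  \<open>K\<close>, and it contains \<open>a\<close>. Its witness is thus within \<alpha> of
  \<open>a\<close>, and \<open>nearest_point_convex_in_ball\<close> carries this bound over to the
  projection.\<close>

lemma core_near_proj:
  assumes "\<sigma> \<in> K" "t \<in> geometric_cell \<sigma>" "a \<in> core t"
  shows "dist a (proj t) < \<alpha>"
proof -
  note fin = finite_simplex[OF assms(1)]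
  have L: "\<sigma> \<in> L" using assms(1) K_subset_L by blast
  have "a \<in> X"
    using assms(3) core_subset_supp[OF fin assms(2)] supp_subset_of_cell[OF assms(2)] assms(1) AX
    by (auto simp: cech_complex_def)
  obtain I w where I: "finite I" "\<And>S. S \<in> I \<Longrightarrow> 0 \<le> w S" "sum w I = (1::real)"
    "\<And>S. S \<in> I \<Longrightarrow> S \<in> L \<and> S \<subseteq> supp t \<and> core t \<subseteq> S" "base t = (\<Sum>S\<in>I. w S *\<^sub>R witness S)"
    using base_convex_combination[OF L assms(2)] by blast
  have "S \<in> K" if "S \<in> I" for S
    using I(4)[OF that] supp_subset_of_cell[OF assms(2)] face_in_cech[OF assms(1)] by blast
  then show ?thesis
    unfolding proj_def I(5)
    by (intro nearest_point_convex_in_ball[OF \<open>a \<in> X\<close> alpha(1,2) I(1-3)])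
      (use I(4) witness AX assms(3) in blast)+
qed

lemma shrink_facts:
  assumes "\<sigma> \<in> L" "t \<in> geometric_cell \<sigma>"
  shows "barycentric (shrink t)" "supp (shrink t) = core t" "core t \<subseteq> supp t" "supp t \<subseteq> \<sigma>"
    "shrink t = core_part \<sigma> t"
proof -
  note fin = finite_simplex[OF assms(1)]
  show eq: "shrink t = core_part \<sigma> t"
    unfolding shrink_def by (rule core_part_supp[OF fin assms(2)])
  show "barycentric (shrink t)"
    using core_part_cell[OF fin assms(2)] fin by (simp add: eq mem_geometric_cell_iff)
  show "supp (shrink t) = core t" unfolding eq by (rule supp_core_part[OF fin assms(2)])
  show "core t \<subseteq> supp t" by (rule core_subset_supp[OF fin assms(2)])
  show "supp t \<subseteq> \<sigma>" by (rule supp_subset_of_cell[OF assms(2)])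
qed

lemma continuous_on_shrink:
  assumes "\<sigma> \<in> L"
  shows "continuous_on (geometric_cell \<sigma>) (\<lambda>t. shrink t a)"
  using continuous_on_core_part[OF finite_simplex[OF assms], of a]
  by (rule continuous_on_eq) (simp add: shrink_facts(5)[OF assms])

text \<open>Shrinking only discards vertices, so each segment stays in the cell of its starting
  point. The vertices that remain are those which \<open>core_near_proj\<close> places near
  \<open>proj t\<close>.\<close>

lemma homotopic_id_shrink:
  "homotopic_with (\<lambda>_. True) (geometric_realization K) (geometric_realization L) id shrink"
proof (rule homotopic_realization_straight_line)
  fix \<sigma> t assume \<sigma>: "\<sigma> \<in> K" and t: "t \<in> geometric_cell \<sigma>"
  then have L: "\<sigma> \<in> L" using K_subset_L by blast
  note facts = shrink_facts[OF L t]
  show "barycentric (id t) \<and> barycentric (shrink t)"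
    using facts(1) t finite_simplex[OF L] by (simp add: mem_geometric_cell_iff)
  show "supp (id t) \<union> supp (shrink t) \<in> L"
    using facts(2-4) face_in_cech[OF L] by (simp add: Un_absorb2)
  show "\<exists>N. open N \<and> t \<in> N \<and> finite (\<Union>t'\<in>geometric_cell \<sigma> \<inter> N. supp (id t') \<union> supp (shrink t'))"
  proof (intro exI conjI)
    show "finite (\<Union>t'\<in>geometric_cell \<sigma> \<inter> UNIV. supp (id t') \<union> supp (shrink t'))"
      by (rule finite_subset[OF _ finite_simplex[OF L]])
        (use shrink_facts(2-4)[OF L] in \<open>simp, blast\<close>)
  qed simp_all
next
  fix \<sigma> a assume "\<sigma> \<in> K"
  then have L: "\<sigma> \<in> L" using K_subset_L by blast
  show "continuous_on (geometric_cell \<sigma>) (\<lambda>t. id t a)" by (simp add: continuous_on_coordinate)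
  show "continuous_on (geometric_cell \<sigma>) (\<lambda>t. shrink t a)" by (rule continuous_on_shrink[OF L])
qed (auto simp: finite_simplex simplicial_complex_cech)

theorem homology_iso_persistent:
  "coeff_homology_group TYPE('g::ab_group_add) k (top_of_set X) \<cong> persistent_homology_group TYPE('g) k K L"
proof -
  have "X \<subseteq> (\<Union>a\<in>A. ball a \<delta>)"
  proof
    fix x assume "x \<in> X"
    then show "x \<in> (\<Union>a\<in>A. ball a \<delta>)" using dense[of x] by (auto simp: dist_commute)
  qed
  then obtain s where
    s: "\<And>x. x \<in> X \<Longrightarrow> barycentric (s x) \<and> supp (s x) \<subseteq> A \<inter> ball x \<delta>"
    and cont_s: "\<And>a. continuous_on X (\<lambda>x. s x a)"
    and fin_s: "\<And>x. x \<in> X \<Longrightarrow> \<exists>N. open N \<and> x \<in> N \<and> finite (\<Union>x'\<in>X \<inter> N. supp (s x'))"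
    by (rule barycentric_partition_of_unity) blast
  have fin: "finite (supp (s x))" if "x \<in> X" for x using s[OF that] by (simp add: barycentric_def)
  have sK: "supp (s x) \<in> K" if x: "x \<in> X" for x
  proof -
    obtain a where a: "a \<in> A" "dist x a < \<delta>" using dense[OF x] by blast
    have "dist v a < \<alpha>" if "v \<in> supp (s x)" for v
    proof -
      have "dist x v < \<delta>" using that s[OF x] by auto
      then show ?thesis using a(2) pos(2) dist_triangle2[of v a x] by (simp add: dist_commute)
    qed
    then show ?thesis using s[OF x] fin[OF x] a(1) by (auto simp: cech_complex_def)
  qed
  have map_s: "continuous_map (top_of_set X) (geometric_realization K) s"
    by (rule continuous_map_into_realization) (simp_all add: s sK cont_s fin_s finite_simplex)
  have incl: "continuous_map (geometric_realization K) (geometric_realization L) id"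
    by (rule continuous_map_geometric_realization_inclusion[OF K_subset_L])
  have "homotopic_with (\<lambda>_. True) (geometric_realization K) (geometric_realization L) shrink (s \<circ> proj)"
  proof (rule homotopic_realization_straight_line)
    fix \<sigma> t assume \<sigma>: "\<sigma> \<in> K" and t: "t \<in> geometric_cell \<sigma>"
    then have L: "\<sigma> \<in> L" using K_subset_L by blast
    note facts = shrink_facts[OF L t]
    have pt: "proj t \<in> X" by (rule proj_in_X[OF L t])
    show "barycentric (shrink t) \<and> barycentric ((s \<circ> proj) t)" using facts(1) s[OF pt] by simp
    \<comment> \<open>Both supports lie in the \<alpha>-ball about \<open>proj t\<close>: the core
      by \<open>core_near_proj\<close>, the other one because \<delta> \<le> \<alpha>.\<close>
    show "supp (shrink t) \<union> supp ((s \<circ> proj) t) \<in> L"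
    proof (rule ball_in_L[OF pt])
      show "finite (supp (shrink t) \<union> supp ((s \<circ> proj) t))"
        using facts(1) fin[OF pt] by (simp add: barycentric_def)
      have "supp (s (proj t)) \<subseteq> A \<inter> ball (proj t) \<alpha>"
        using s[OF pt] pos subset_ball[of \<delta> \<alpha> "proj t"] by auto
      moreover have "core t \<subseteq> A"
        using facts(3,4) \<sigma> by (auto simp: cech_complex_def)
      moreover have "core t \<subseteq> ball (proj t) \<alpha>"
        using core_near_proj[OF \<sigma> t] by (auto simp: dist_commute)
      ultimately show "supp (shrink t) \<union> supp ((s \<circ> proj) t) \<subseteq> A \<inter> ball (proj t) \<alpha>"
        by (simp add: facts(2))
    qed
    obtain N where N: "open N" "proj t \<in> N" "finite (\<Union>x'\<in>X \<inter> N. supp (s x'))"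
      using fin_s[OF pt] by blast
    \<comment> \<open>The neighbourhood on which \<open>s\<close> uses finitely many vertices is
      pulled back along \<open>proj\<close>, relative to the cell.\<close>
    obtain W where W: "open W" "geometric_cell \<sigma> \<inter> proj -` N = geometric_cell \<sigma> \<inter> W"
      using continuous_openin_preimage_gen[OF continuous_on_proj[OF L] N(1)] by (auto simp: openin_open)
    show "\<exists>N. open N \<and> t \<in> N \<and> finite (\<Union>t'\<in>geometric_cell \<sigma> \<inter> N. supp (shrink t') \<union> supp ((s \<circ> proj) t'))"
    proof (intro exI conjI)
      show "open W" by (rule W)
      show "t \<in> W" using W(2) t N(2) by auto
      show "finite (\<Union>t'\<in>geometric_cell \<sigma> \<inter> W. supp (shrink t') \<union> supp ((s \<circ> proj) t'))"
        by (rule finite_subset[OF _ finite_UnI[OF finite_simplex[OF L] N(3)]])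
          (use shrink_facts(2-4)[OF L] proj_in_X[OF L] in \<open>simp flip: W(2), blast\<close>)
    qed
  next
    fix \<sigma> a assume "\<sigma> \<in> K"
    then have L: "\<sigma> \<in> L" using K_subset_L by blast
    show "continuous_on (geometric_cell \<sigma>) (\<lambda>t. shrink t a)" by (rule continuous_on_shrink[OF L])
    show "continuous_on (geometric_cell \<sigma>) (\<lambda>t. (s \<circ> proj) t a)"
      using continuous_on_compose2[OF cont_s continuous_on_proj[OF L]] proj_in_X[OF L] by auto
  qed (auto simp: finite_simplex simplicial_complex_cech)
  from homotopic_with_symD[OF homotopic_with_trans[OF homotopic_id_shrink this]]
  have sq: "homotopic_with (\<lambda>_. True) (geometric_realization K) (geometric_realization L) (s \<circ> proj) id" .
  \<comment> \<open>The formula for the homotopy ends at \<open>nearest_point X\<close> as a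
    function on the whole type. It agrees with \<open>id\<close> on \<open>X\<close>, which is
    enough to replace it afterwards.\<close>
  have "homotopic_with (\<lambda>_. True) (top_of_set X) (top_of_set X) (proj \<circ> s) (nearest_point X)"
    unfolding homotopic_with_def
  proof (intro exI conjI ballI allI)
    let ?h = "\<lambda>z. nearest_point X ((1 - fst z) *\<^sub>R base (s (snd z)) + fst z *\<^sub>R snd z)"
    have "continuous_map (top_of_set X) euclidean (base \<circ> s)"
      using continuous_map_compose[OF continuous_map_compose[OF map_s incl] continuous_map_base] by simp
    then have cont: "continuous_on X (\<lambda>x. base (s x))" by (simp add: o_def)
    \<comment> \<open>A core vertex \<open>v\<close> is within \<delta> of \<open>x\<close>, and the
      averaged witnesses are within \<alpha> of \<open>v\<close> because their faces lie in
      \<open>K\<close>; here \<open>\<alpha> + \<delta> \<le> R\<close> enters.\<close>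
    have near: "base (s x) \<in> ball x R" if x: "x \<in> X" for x
    proof -
      let ?t = "s x" and ?\<sigma> = "supp (s x)"
      have L: "?\<sigma> \<in> L" using sK[OF x] K_subset_L by blast
      have t: "?t \<in> geometric_cell ?\<sigma>" using s[OF x] fin[OF x] by (simp add: mem_geometric_cell_iff)
      obtain v where v: "v \<in> core ?t" using core_nonempty[OF fin[OF x] t] by blast
      obtain I w where I: "finite I" "\<And>S. S \<in> I \<Longrightarrow> 0 \<le> w S" "sum w I = (1::real)"
        "\<And>S. S \<in> I \<Longrightarrow> S \<in> L \<and> S \<subseteq> supp ?t \<and> core ?t \<subseteq> S" "base ?t = (\<Sum>S\<in>I. w S *\<^sub>R witness S)"
        using base_convex_combination[OF L t] by blast
      have "witness S \<in> ball x R" if S: "S \<in> I" for S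
      proof -
        have "S \<in> K"
          using I(4)[OF S] face_in_cech[OF sK[OF x]] by blast
        then have "dist v (witness S) < \<alpha>" using witness(3)[of S v] I(4)[OF S] v by blast
        moreover have "v \<in> ball x \<delta>" using I(4)[OF S] v s[OF x] by blast
        ultimately show ?thesis using dist_triangle[of x "witness S" v] le(1) by simp
      qed
      then show ?thesis unfolding I(5) using I by (intro convex_sum) auto
    qed
    have tube: "(1 - u) *\<^sub>R base (s x) + u *\<^sub>R x \<in> ball x R" if "x \<in> X" "u \<in> {0..1}" for x u
      using near[OF that(1)] that R by (intro convexD[OF convex_ball]) auto
    have "continuous_on ({0..1} \<times> X) ?h"
    proof (rule continuous_on_compose2[OF continuous_on_nearest_point])
      show "continuous_on ({0..1} \<times> X) (\<lambda>z. (1 - fst z) *\<^sub>R base (s (snd z)) + fst z *\<^sub>R snd z)"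
        by (intro continuous_intros continuous_on_compose2[OF cont]) auto
      show "(\<lambda>z. (1 - fst z) *\<^sub>R base (s (snd z)) + fst z *\<^sub>R snd z) ` ({0..1} \<times> X) \<subseteq> (\<Union>x\<in>X. ball x R)"
      proof
        fix y assume "y \<in> (\<lambda>z. (1 - fst z) *\<^sub>R base (s (snd z)) + fst z *\<^sub>R snd z) ` ({0..1} \<times> X)"
        then obtain u x where "u \<in> {0..1}" "x \<in> X" "y = (1 - u) *\<^sub>R base (s x) + u *\<^sub>R x" by auto
        with tube show "y \<in> (\<Union>x\<in>X. ball x R)" by blast
      qed
    qed
    moreover have "?h z \<in> X" if "z \<in> {0..1} \<times> X" for z
    proof -
      have z: "fst z \<in> {0..1}" "snd z \<in> X" using that by auto
      show ?thesis using nearest_point_in[OF subsetD[OF ball_Unp[OF z(2)] tube[OF z(2,1)]]] .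
    qed
    ultimately show "continuous_map (prod_topology (top_of_set {0..1}) (top_of_set X)) (top_of_set X) ?h"
      by (auto simp: continuous_map_in_subtopology)
  qed (auto simp: proj_def)
  then have qs: "homotopic_with (\<lambda>_. True) (top_of_set X) (top_of_set X) (proj \<circ> s) id"
    by (rule homotopic_with_eq) (auto simp: nearest_self)
  show ?thesis
    unfolding persistent_homology_group_def
    by (rule coeff_homology_iso_image[OF map_s incl continuous_map_proj qs sq])
qed

end

text \<open>The supremum defining the local reach need not be attained, so each point of the open
  ball gets its own radius \<open>r'\<close>.\<close>

lemma ball_subset_Unp:
  assumes "ennreal r \<le> reach X" "x \<in> X"
  shows "ball x r \<subseteq> Unp X"
proof
  fix p assume "p \<in> ball x r"
  then have "ennreal (dist x p) < ennreal r" by (simp add: ennreal_lessI order_le_less_trans[OF zero_le_dist])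
  also have "\<dots> \<le> local_reach X x" using assms unfolding reach_def by (meson INF_lower order_trans)
  finally obtain r' where "ball x r' \<subseteq> Unp X" "ennreal (dist x p) < ennreal r'"
    unfolding local_reach_def by (auto simp: less_SUP_iff)
  then show "p \<in> Unp X" by (auto simp: ennreal_less_iff)
qed

theorem theorem6p7:
  fixes X A :: "(real ^ 'n) set"
    and d \<tau> :: ennreal
    and \<alpha> \<epsilon> :: real
    and k :: nat
  assumes "\<tau> = reach X" and "\<tau> > 0"
    and "A \<subseteq> X"
    and "d = directed_hausdorff X A" and "d < \<tau> / 3"
    and "2 * d < ennreal \<alpha>" and "ennreal \<alpha> < \<tau> - d"
    and "d < ennreal \<epsilon>" and "ennreal \<epsilon> \<le> \<tau> - ennreal \<alpha>"
  shows "coeff_homology_group TYPE('g::ab_group_add) k (top_of_set X) \<cong>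
         persistent_homology_group TYPE('g) k (cech_complex A A \<alpha>) (cech_complex A A (\<alpha> + \<epsilon>))"
proof -
  have "d < \<infinity>" using assms(5) by (metis infinity_ennreal_def order_less_le_trans top_greatest)
  then obtain D where D: "d = ennreal D" "D \<ge> 0" by (cases d) simp_all
  have \<alpha>: "2 * D < \<alpha>" using assms(6) D
    by (metis ennreal_less_iff ennreal_mult' ennreal_numeral mult_nonneg_nonneg zero_le_numeral)
  have \<epsilon>: "D < \<epsilon>" using assms(8) D by (simp add: ennreal_less_iff)
  \<comment> \<open>The upper bound on \<alpha> is strict; \<open>r\<close> is the room it leaves
    for a radius larger than \<open>D\<close>.\<close>
  have "ennreal (\<alpha> + \<epsilon>) \<le> \<tau> \<and> (\<exists>r>0. ennreal (\<alpha> + (D + r)) \<le> \<tau>)"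
  proof (cases \<tau>)
    case (real T)
    have "ennreal \<alpha> < ennreal (T - D)" using assms(7) D real by (simp add: ennreal_minus)
    then have T: "\<alpha> < T - D" using \<alpha> D(2) by (simp add: ennreal_less_iff)
    have "ennreal \<epsilon> \<le> ennreal (T - \<alpha>)" using assms(9) \<alpha> D(2) real by (simp add: ennreal_minus)
    \<comment> \<open>\<open>ennreal\<close> sends negative numbers to 0, so the comparison of reals
      uses that \<open>T - \<alpha>\<close> is not negative.\<close>
    then have "\<epsilon> \<le> T - \<alpha>" using T D(2) by (subst (asm) ennreal_le_iff) auto
    then have "ennreal (\<alpha> + \<epsilon>) \<le> \<tau>" using real by (simp add: ennreal_leI)
    moreover have "ennreal (\<alpha> + (D + (T - D - \<alpha>))) \<le> \<tau>" using real by simp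
    ultimately show ?thesis using T by (intro conjI exI[of _ "T - D - \<alpha>"]) auto
  next
    case top
    then show ?thesis by (auto intro: exI[of _ 1])
  qed
  then obtain r where \<alpha>\<epsilon>: "ennreal (\<alpha> + \<epsilon>) \<le> \<tau>" and r: "r > 0" "ennreal (\<alpha> + (D + r)) \<le> \<tau>" by blast
  \<comment> \<open>Each of the three numbers exceeds \<open>D\<close>, hence so does \<delta>: the
    first keeps \<open>\<alpha> + \<delta>\<close> within the reach, the others are the bounds
    \<open>2 * \<delta> \<le> \<alpha>\<close> and \<open>\<delta> \<le> \<epsilon>\<close>.\<close>
  define \<delta> where "\<delta> = Min {D + r, \<alpha> / 2, \<epsilon>}"
  define R where "R = max (\<alpha> + \<delta>) (\<alpha> + \<epsilon>)"
  have \<delta>: "D < \<delta>" "\<delta> \<le> D + r" "2 * \<delta> \<le> \<alpha>" "\<delta> \<le> \<epsilon>" using \<alpha> \<epsilon> r(1) by (auto simp: \<delta>_def min_def)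
  have "ennreal (\<alpha> + \<delta>) \<le> \<tau>" using \<delta>(2) r(2) by (meson add_left_mono ennreal_leI order_trans)
  then have R: "ennreal R \<le> reach X" using \<alpha>\<epsilon> assms(1) by (auto simp: R_def max_def)
  have "cech_reach X R A \<alpha> \<epsilon> \<delta>"
  proof
    show "0 < R" using \<alpha> \<epsilon> D(2) by (simp add: R_def)
    show "ball x R \<subseteq> Unp X" if "x \<in> X" for x using ball_subset_Unp[OF R that] .
    show "\<exists>a\<in>A. dist x a < \<delta>" if "x \<in> X" for x
    proof -
      have "(INF a\<in>A. ennreal (dist x a)) \<le> d"
        using that unfolding assms(4) directed_hausdorff_def by (rule SUP_upper)
      also have "d < ennreal \<delta>" using \<delta>(1) D by (simp add: ennreal_less_iff)
      finally show ?thesis by (auto simp: INF_less_iff ennreal_less_iff)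
    qed
  qed (use assms(3) D(2) \<delta> in \<open>auto simp: R_def\<close>)
  then show ?thesis by (rule cech_reach.homology_iso_persistent)
qed

end
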